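(* Let $S$ be a bounded measurable subset of $(0,\infty)$ and let $\alpha>-1/2$. If the set $\Lambda=\{t_n\}_{n=0}^{\infty}\subset(0,\infty)$ is a set of interpolation for $\mathcal{B}_\alpha(S)$, then $$D^{+}(\Lambda)\ \leq\ \frac{1}{\pi}\,m(S),$$ where $m(S)$ denotes the Lebesgue measure of $S$.
   Context: $J_\alpha$ is the Bessel function of the first kind of order $\alpha$. The Hankel transform is $H_\alpha(f)(x)=\int_0^\infty f(t)(xt)^{1/2}J_\alpha(xt)\,dt$, extended to a unitary involution of $L^2(0,\infty)$. $\mathcal{B}_\alpha(S)$ is the space of $f\in L^2(0,\infty)$ whose Hankel transform is supported in $S$ (i.e. vanishes a.e. outside $S$). Since $S$ is bounded, each $f\in\mathcal{B}_\alpha(S)$ is identified with its continuous representative $f(t)=\int_S H_\alpha f(x)(tx)^{1/2}J_\alpha(tx)\,dx$, so point values make sense. $\Lambda=\{t_n\}_{n=0}^\infty$ (pairwise distinct points) is a set of interpolation for $\mathcal{B}_\alpha(S)$ if for every sequence of numbers $\{a_n\}_{n=0}^\infty$ with $\sum|a_n|^2<\infty$ there exists $f\in\mathcal{B}_\alpha(S)$ with $f(t_n)=a_n$ for every $n$. For $a\ge0$, $r>0$, let $n_a(r)$ be the number of points of $\Lambda$ in $[a,a+r]$. The upper density is $D^+(\Lambda)=\limsup_{r\to\infty}\ \sup_{a\ge0}\frac{n_a(r)}{r}$. *)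

theory Defs
  imports "HOL-Analysis.Analysis"
begin

text \<open>
  The Bessel function of the first kind of real order, for positive arguments
  (for \<open>x \<le> 0\<close> the factor involving \<open>powr\<close> has no intended meaning, and it is never used there).
  The entire function \<open>rGamma\<close> is the reciprocal of \<open>Gamma\<close>.
\<close>

definition bessel_J :: "real \<Rightarrow> real \<Rightarrow> real" where
  "bessel_J \<alpha> x =
     (x / 2) powr \<alpha> * (\<Sum>k. (-1) ^ k * rGamma (\<alpha> + real k + 1) / fact k * (x / 2) ^ (2 * k))"

definition hankel_kernel :: "real \<Rightarrow> real \<Rightarrow> real \<Rightarrow> real" where
  "hankel_kernel \<alpha> x t = sqrt (x * t) * bessel_J \<alpha> (x * t)"

definition hankel_integral :: "real \<Rightarrow> (real \<Rightarrow> complex) \<Rightarrow> real \<Rightarrow> complex" where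
  "hankel_integral \<alpha> f x = (LINT t|lebesgue_on {0<..}. hankel_kernel \<alpha> x t *\<^sub>R f t)"

definition L2_half_line :: "(real \<Rightarrow> complex) set" where
  "L2_half_line =
     {f. f \<in> borel_measurable (lebesgue_on {0<..}) \<and>
         integrable (lebesgue_on {0<..}) (\<lambda>x. (norm (f x))\<^sup>2)}"

definition L2_tendsto :: "(nat \<Rightarrow> real \<Rightarrow> complex) \<Rightarrow> (real \<Rightarrow> complex) \<Rightarrow> bool" where
  "L2_tendsto \<phi> f \<longleftrightarrow>
     (\<lambda>n. \<integral>\<^sup>+ x. ennreal ((norm (\<phi> n x - f x))\<^sup>2) \<partial>lebesgue_on {0<..}) \<longlonglongrightarrow> 0"

text \<open>
  The extension of the Hankel transform to \<open>L\<^sup>2(0,\<infinity>)\<close>: the closure in \<open>L\<^sup>2 \<times> L\<^sup>2\<close> of the graph of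
  the integral transform on \<open>L\<^sup>1 \<inter> L\<^sup>2\<close>, where the integral converges absolutely because the
  kernel is bounded for \<open>\<alpha> \<ge> -1/2\<close>.  It is a relation between functions rather than a function,
  since the transform is determined only up to a null set.
\<close>

definition has_hankel_transform ::
    "real \<Rightarrow> (real \<Rightarrow> complex) \<Rightarrow> (real \<Rightarrow> complex) \<Rightarrow> bool" where
  "has_hankel_transform \<alpha> f g \<longleftrightarrow>
     f \<in> L2_half_line \<and> g \<in> L2_half_line \<and>
     (\<exists>\<phi>. (\<forall>n. \<phi> n \<in> L2_half_line \<and> integrable (lebesgue_on {0<..}) (\<phi> n)) \<and>
          L2_tendsto \<phi> f \<and> L2_tendsto (\<lambda>n. hankel_integral \<alpha> (\<phi> n)) g)"

text \<open>
  The space \<open>B\<^sub>\<alpha>(S)\<close> for bounded \<open>S\<close>.  The last conjunct selects from each class of a.e. equal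
  functions the continuous representative, so that point values on \<open>(0,\<infinity>)\<close> make sense; values at
  nonpositive arguments are irrelevant.
\<close>

definition hankel_space :: "real \<Rightarrow> real set \<Rightarrow> (real \<Rightarrow> complex) set" where
  "hankel_space \<alpha> S =
     {f \<in> L2_half_line. \<exists>g. has_hankel_transform \<alpha> f g \<and>
        (AE x in lebesgue_on {0<..}. x \<notin> S \<longrightarrow> g x = 0) \<and>
        (\<forall>t>0. f t = (LINT x|lebesgue_on S. hankel_kernel \<alpha> t x *\<^sub>R g x))}"

definition interpolation_set :: "real \<Rightarrow> real set \<Rightarrow> (nat \<Rightarrow> real) \<Rightarrow> bool" where
  "interpolation_set \<alpha> S t \<longleftrightarrow>
     (\<forall>a :: nat \<Rightarrow> complex. summable (\<lambda>n. (norm (a n))\<^sup>2) \<longrightarrow>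
        (\<exists>f \<in> hankel_space \<alpha> S. \<forall>n. f (t n) = a n))"

text \<open>
  Points are counted with the counting measure, which, unlike \<open>card\<close>, is infinite on infinite sets:
  a set with infinitely many points in some bounded interval has infinite upper density.
\<close>

definition upper_density :: "real set \<Rightarrow> ennreal" where
  "upper_density \<Lambda> =
     Limsup at_top (\<lambda>r::real. SUP a\<in>{0..}.
       emeasure (count_space UNIV) (\<Lambda> \<inter> {a..a + r}) / ennreal r)"

end

theory Submission
  imports Defs
begin

text \<open>
  If the points \<open>t n\<close> are a set of interpolation, uniform boundedness makes the functions
  \<open>e n x = k (t n * x)\<close> on \<open>S\<close>, where \<open>k u = sqrt u * J u\<close>, a Riesz sequence in \<open>L\<^sup>2(S)\<close>.  Take
  the points in a window \<open>[a, a + r]\<close> far from the origin.  There \<open>k\<close> is nearly a sinusoid, so each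
  \<open>e n\<close> is close to the span \<open>W\<close> of the trigonometric functions on a long interval \<open>[0, L]\<close>
  with frequencies within a bounded distance of the window.  If \<open>P\<close> and \<open>Q\<close> are the orthogonal
  projections onto the span of the \<open>e n\<close> and onto \<open>W\<close>, the trace of \<open>P Q\<close> is therefore almost the
  number of points; on the other hand it is at most the sum of \<open>\<parallel>P \<phi>\<parallel>\<^sup>2 \<le> \<parallel>1\<^sub>S \<phi>\<parallel>\<^sup>2\<close> over an
  orthonormal basis of \<open>W\<close>.  Each frequency contributes \<open>2 m(S) / L\<close>, and there are about
  \<open>r L / (2 \<pi>)\<close> of them, whence the bound \<open>r m(S) / \<pi>\<close>.  The amplitude and the phase of the
  sinusoid are irrelevant, so the differential equation of \<open>k\<close> yields all that is needed about
  its asymptotics.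
\<close>

text \<open>The error must not grow with the window, so every auxiliary choice precedes it. The
  Riesz constant fixes the accuracy; the accuracy fixes \<open>L\<close> and a trigonometric
  polynomial, of some degree \<open>R\<close>, close to the indicator of \<open>S\<close>.
  Multiplying it by a sinusoid only translates its spectrum, so the band of frequencies exceeds the
  window by about \<open>R\<close> on either side, wherever the window lies. The approximation has
  to be good in mean square on all of [0, L], where the basis is orthonormal, and not only on
  \<open>S\<close>: the approximant must be small where \<open>e n\<close> vanishes. Distance from
  the origin serves two purposes: the kernel is then close to its limiting sinusoid, and all
  frequencies in use are positive, so that cosines and sines share one normalisation. The points
  near the origin are finitely many, because two very close points would contradict the Riesz bound;
  they add only a constant. Division by \<open>r\<close> removes all constants, and the accuracy
  tends to zero last.\<close>

section \<open>Square-integrable functions and the trace estimate\<close>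

text \<open>Real-valued functions suffice although the Hankel space is complex: the kernel is real,
  so the real part of a solution of a moment problem with real data is again a solution. Functions
  are not identified modulo null sets, hence the inner product below is only semidefinite.\<close>

definition square_integrable :: "'a measure \<Rightarrow> ('a \<Rightarrow> real) \<Rightarrow> bool" where
  "square_integrable M f \<longleftrightarrow> f \<in> borel_measurable M \<and> integrable M (\<lambda>x. (f x)\<^sup>2)"

definition L2_inner :: "'a measure \<Rightarrow> ('a \<Rightarrow> real) \<Rightarrow> ('a \<Rightarrow> real) \<Rightarrow> real" where
  "L2_inner M f g = (LINT x|M. f x * g x)"

lemma square_integrable_mult:
  assumes "square_integrable M f" "square_integrable M g"
  shows "integrable M (\<lambda>x. f x * g x)"
proof (rule Bochner_Integration.integrable_bound)
  show "integrable M (\<lambda>x. (f x)\<^sup>2 + (g x)\<^sup>2)"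
    using assms by (auto simp: square_integrable_def)
  show "(\<lambda>x. f x * g x) \<in> borel_measurable M"
    using assms by (auto simp: square_integrable_def)
  have "\<bar>a * b\<bar> \<le> a\<^sup>2 + b\<^sup>2" for a b :: real
  proof -
    have "0 \<le> \<bar>a\<bar> * \<bar>b\<bar>" by simp
    then show ?thesis
      using sum_squares_bound[of "\<bar>a\<bar>" "\<bar>b\<bar>"] unfolding abs_mult power2_abs by linarith
  qed
  then show "AE x in M. norm (f x * g x) \<le> norm ((f x)\<^sup>2 + (g x)\<^sup>2)"
    by (auto intro!: AE_I2 order_trans[OF _ abs_ge_self])
qed

lemma square_integrable_zero [simp]: "square_integrable M (\<lambda>x. 0)"
  by (simp add: square_integrable_def)

lemma square_integrable_cmult [intro]:
  "square_integrable M f \<Longrightarrow> square_integrable M (\<lambda>x. c * f x)"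
  by (auto simp: square_integrable_def power_mult_distrib)

lemma square_integrable_add [intro]:
  assumes "square_integrable M f" "square_integrable M g"
  shows "square_integrable M (\<lambda>x. f x + g x)"
proof -
  have "(\<lambda>x. (f x + g x)\<^sup>2) = (\<lambda>x. (f x)\<^sup>2 + (g x)\<^sup>2 + 2 * (f x * g x))"
    by (auto simp: power2_eq_square algebra_simps)
  then show ?thesis
    using assms square_integrable_mult[OF assms] by (auto simp: square_integrable_def)
qed

lemma square_integrable_diff [intro]:
  assumes "square_integrable M f" "square_integrable M g"
  shows "square_integrable M (\<lambda>x. f x - g x)"
  using square_integrable_add[OF assms(1) square_integrable_cmult[OF assms(2), of "-1"]] by simp

lemma square_integrable_lincomb [intro]:
  assumes "\<And>i. i \<in> A \<Longrightarrow> square_integrable M (f i)"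
  shows "square_integrable M (\<lambda>x. \<Sum>i\<in>A. c i * f i x)"
  using assms
  by (induction A rule: infinite_finite_induct) (simp_all add: square_integrable_add square_integrable_cmult)

lemma L2_inner_commute: "L2_inner M f g = L2_inner M g f"
  by (simp add: L2_inner_def mult.commute)

lemma L2_inner_nonneg: "0 \<le> L2_inner M f f"
  by (simp add: L2_inner_def)

lemma L2_inner_add_left:
  assumes "square_integrable M f" "square_integrable M g" "square_integrable M h"
  shows "L2_inner M (\<lambda>x. f x + g x) h = L2_inner M f h + L2_inner M g h"
  using assms by (simp add: L2_inner_def distrib_right square_integrable_mult)

lemma L2_inner_diff_left:
  assumes "square_integrable M f" "square_integrable M g" "square_integrable M h"
  shows "L2_inner M (\<lambda>x. f x - g x) h = L2_inner M f h - L2_inner M g h"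
  using assms by (simp add: L2_inner_def left_diff_distrib square_integrable_mult)

lemma L2_inner_cmult_left: "L2_inner M (\<lambda>x. c * f x) h = c * L2_inner M f h"
  by (simp add: L2_inner_def mult.assoc)

lemma L2_inner_add_right:
  assumes "square_integrable M f" "square_integrable M g" "square_integrable M h"
  shows "L2_inner M h (\<lambda>x. f x + g x) = L2_inner M h f + L2_inner M h g"
  using L2_inner_add_left[OF assms] by (simp add: L2_inner_commute)

lemma L2_inner_diff_right:
  assumes "square_integrable M f" "square_integrable M g" "square_integrable M h"
  shows "L2_inner M h (\<lambda>x. f x - g x) = L2_inner M h f - L2_inner M h g"
  using L2_inner_diff_left[OF assms] by (simp add: L2_inner_commute)

lemma L2_inner_cmult_right: "L2_inner M h (\<lambda>x. c * f x) = c * L2_inner M h f"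
  using L2_inner_cmult_left[of M c f h] by (simp add: L2_inner_commute)

lemma L2_inner_sum_left:
  assumes "\<And>i. i \<in> A \<Longrightarrow> square_integrable M (f i)" "square_integrable M h"
  shows "L2_inner M (\<lambda>x. \<Sum>i\<in>A. c i * f i x) h = (\<Sum>i\<in>A. c i * L2_inner M (f i) h)"
  using assms
proof (induction A rule: infinite_finite_induct)
  case (insert a A)
  have "L2_inner M (\<lambda>x. c a * f a x + (\<Sum>i\<in>A. c i * f i x)) h
      = L2_inner M (\<lambda>x. c a * f a x) h + L2_inner M (\<lambda>x. \<Sum>i\<in>A. c i * f i x) h"
    using insert by (intro L2_inner_add_left) auto
  then show ?case using insert by (simp add: L2_inner_cmult_left)
qed (auto simp: L2_inner_def)

lemma L2_inner_sum_right:
  assumes "\<And>i. i \<in> A \<Longrightarrow> square_integrable M (f i)" "square_integrable M h"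
  shows "L2_inner M h (\<lambda>x. \<Sum>i\<in>A. c i * f i x) = (\<Sum>i\<in>A. c i * L2_inner M h (f i))"
  using L2_inner_sum_left[OF assms] by (simp add: L2_inner_commute)

lemma L2_Cauchy_Schwarz:
  assumes "square_integrable M f" "square_integrable M g"
  shows "(L2_inner M f g)\<^sup>2 \<le> L2_inner M f f * L2_inner M g g"
proof -
  define a b c where "a = L2_inner M f f" and "b = L2_inner M f g" and "c = L2_inner M g g"
  have quad: "0 \<le> s\<^sup>2 * a - 2 * s * r * b + r\<^sup>2 * c" for s r
  proof -
    have "0 \<le> L2_inner M (\<lambda>x. s * f x - r * g x) (\<lambda>x. s * f x - r * g x)"
      by (rule L2_inner_nonneg)
    also have "\<dots> = s\<^sup>2 * a - 2 * s * r * b + r\<^sup>2 * c"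
      using assms L2_inner_commute[of M g f]
      by (simp add: L2_inner_diff_left L2_inner_diff_right square_integrable_cmult square_integrable_diff
           L2_inner_cmult_left L2_inner_cmult_right a_def b_def c_def algebra_simps power2_eq_square)
    finally show ?thesis .
  qed
  have c0: "0 \<le> c" by (simp add: c_def L2_inner_nonneg)
  show ?thesis
  proof (cases "c = 0")
    case True
    have "b = 0"
    proof (rule ccontr)
      assume "b \<noteq> 0"
      then show False
        \<comment> \<open>For \<open>c = 0\<close> the form is affine in \<open>r\<close>; this
          value makes it equal to -1.\<close>
        using quad[of 1 "(a + 1) / (2 * b)"] True by (simp add: field_simps)
    qed
    then show ?thesis using True by (simp add: a_def b_def c_def)
  next
    case False
    have "0 \<le> c\<^sup>2 * a - 2 * c * b * b + b\<^sup>2 * c" using quad[of c b] by simp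
    also have "\<dots> = c * (a * c - b\<^sup>2)" by (simp add: power2_eq_square algebra_simps)
    finally have "0 \<le> a * c - b\<^sup>2" using False c0 by (simp add: zero_le_mult_iff)
    then show ?thesis by (simp add: a_def b_def c_def)
  qed
qed

lemma L2_inner_le:
  assumes "square_integrable M f" "square_integrable M g"
  shows "\<bar>L2_inner M f g\<bar> \<le> sqrt (L2_inner M f f) * sqrt (L2_inner M g g)"
  using L2_Cauchy_Schwarz[OF assms] by (metis real_sqrt_abs real_sqrt_le_iff real_sqrt_mult)

lemma L2_norm_triangle:
  assumes "square_integrable M f" "square_integrable M g"
  shows "sqrt (L2_inner M (\<lambda>x. f x + g x) (\<lambda>x. f x + g x))
       \<le> sqrt (L2_inner M f f) + sqrt (L2_inner M g g)"
proof (rule real_le_lsqrt)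
  have "L2_inner M (\<lambda>x. f x + g x) (\<lambda>x. f x + g x)
      = L2_inner M f f + 2 * L2_inner M f g + L2_inner M g g"
    using assms L2_inner_commute[of M g f]
    by (simp add: L2_inner_add_left L2_inner_add_right square_integrable_add)
  also have "\<dots> \<le> (sqrt (L2_inner M f f) + sqrt (L2_inner M g g))\<^sup>2"
    using L2_inner_le[OF assms] by (simp add: power2_sum L2_inner_nonneg)
  finally show "L2_inner M (\<lambda>x. f x + g x) (\<lambda>x. f x + g x)
      \<le> (sqrt (L2_inner M f f) + sqrt (L2_inner M g g))\<^sup>2" .
qed (auto simp: L2_inner_nonneg)

text \<open>The inverse grows by one index at a time, through a Gram-Schmidt step carried out on
  coefficients. Row \<open>i\<close> of \<open>g\<close> is meant as the coefficients of the dual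
  basis vector of index \<open>i\<close>; only the form enters, no vectors.\<close>

lemma gram_inverse_exists:
  fixes G :: "'i \<Rightarrow> 'i \<Rightarrow> real"
  assumes "finite F" and "\<And>i j. G i j = G j i"
    and "\<And>c. \<exists>i\<in>F. c i \<noteq> 0 \<Longrightarrow> 0 < (\<Sum>i\<in>F. \<Sum>j\<in>F. c i * c j * G i j)"
  shows "\<exists>g. \<forall>i\<in>F. \<forall>j\<in>F. (\<Sum>k\<in>F. g i k * G k j) = of_bool (i = j)"
  using assms(1,3)
proof (induction F)
  case empty
  then show ?case by simp
next
  case (insert v F)
  have "0 < (\<Sum>i\<in>F. \<Sum>j\<in>F. c i * c j * G i j)" if "\<exists>i\<in>F. c i \<noteq> 0" for c
  proof -
    have "0 < (\<Sum>i\<in>insert v F. \<Sum>j\<in>insert v F. (c(v := 0)) i * (c(v := 0)) j * G i j)"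
      using that insert.hyps by (intro insert.prems) auto
    also have "\<dots> = (\<Sum>i\<in>F. \<Sum>j\<in>F. (c(v := 0)) i * (c(v := 0)) j * G i j)"
      using insert.hyps by simp
    also have "\<dots> = (\<Sum>i\<in>F. \<Sum>j\<in>F. c i * c j * G i j)"
      using insert.hyps by (intro sum.cong refl) auto
    finally show ?thesis .
  qed
  from insert.IH[OF this] obtain g
    where g: "\<And>i j. i \<in> F \<Longrightarrow> j \<in> F \<Longrightarrow> (\<Sum>k\<in>F. g i k * G k j) = of_bool (i = j)"
    by blast
  \<comment> \<open>The coefficients of the component of the new vector orthogonal to the old ones.\<close>
  define p where "p k = (if k = v then 1 else - (\<Sum>l\<in>F. G v l * g l k))" for k
  define N where "N = (\<Sum>k\<in>insert v F. p k * G k v)"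
  have vF: "k \<in> F \<Longrightarrow> k \<noteq> v" for k using insert.hyps by auto
  have pv: "(\<Sum>k\<in>insert v F. p k * q k) = q v - (\<Sum>l\<in>F. G v l * (\<Sum>k\<in>F. g l k * q k))" for q
  proof -
    have "(\<Sum>k\<in>F. p k * q k) = (\<Sum>k\<in>F. - (\<Sum>l\<in>F. G v l * g l k) * q k)"
      by (intro sum.cong refl) (auto simp: p_def vF)
    also have "\<dots> = - (\<Sum>k\<in>F. \<Sum>l\<in>F. G v l * g l k * q k)"
      by (simp add: sum_negf sum_distrib_right)
    also have "\<dots> = - (\<Sum>l\<in>F. \<Sum>k\<in>F. G v l * g l k * q k)"
      by (subst sum.swap) simp
    finally show ?thesis using insert.hyps by (simp add: p_def sum_distrib_left mult.assoc)
  qed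
  have p0: "(\<Sum>k\<in>insert v F. p k * G k j) = 0" if "j \<in> F" for j
  proof -
    have "(\<Sum>l\<in>F. G v l * (\<Sum>k\<in>F. g l k * G k j)) = (\<Sum>l\<in>F. if l = j then G v j else 0)"
      using that by (intro sum.cong) (auto simp: g)
    then show ?thesis using that insert.hyps by (subst pv) simp
  qed
  \<comment> \<open>Positivity is tested on the orthogonal component. Since \<open>p\<close> pairs
    to zero with the old indices and \<open>p v = 1\<close>, its squared length is its pairing
    \<open>N\<close> with the new index.\<close>
  have "0 < (\<Sum>i\<in>insert v F. \<Sum>j\<in>insert v F. p i * p j * G i j)"
    by (intro insert.prems) (auto simp: p_def)
  also have "\<dots> = (\<Sum>j\<in>insert v F. p j * (\<Sum>i\<in>insert v F. p i * G i j))"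
    unfolding sum_distrib_left by (subst sum.swap) (simp add: mult_ac)
  also have "\<dots> = (\<Sum>j\<in>insert v F. if j = v then N else 0)"
    by (intro sum.cong refl) (use p0 in \<open>auto simp: N_def p_def\<close>)
  also have "\<dots> = N" using insert.hyps by simp
  finally have N: "0 < N" .
  define r where "r i = (\<Sum>k\<in>F. g i k * G k v)" for i
  \<comment> \<open>The dual vector of \<open>v\<close> is the orthogonal component divided by
    \<open>N\<close>. Subtracting a multiple of it from an old dual vector leaves the pairings with
    \<open>F\<close> intact, and the factor \<open>r i\<close> makes the pairing with
    \<open>v\<close> vanish.\<close>
  define g' where "g' i k = (if i = v then p k / N
      else (if k = v then 0 else g i k) - r i * p k / N)" for i k
  have "(\<Sum>k\<in>insert v F. g' i k * G k j) = of_bool (i = j)"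
    if "i \<in> insert v F" "j \<in> insert v F" for i j
  proof (cases "i = v")
    case True
    have "(\<Sum>k\<in>insert v F. g' i k * G k j) = (\<Sum>k\<in>insert v F. p k * G k j) / N"
      unfolding sum_divide_distrib by (intro sum.cong refl) (simp add: g'_def True)
    then show ?thesis using that N p0 True vF by (cases "j = v") (auto simp: N_def[symmetric])
  next
    case False
    then have i: "i \<in> F" using that by auto
    have "(\<Sum>k\<in>insert v F. g' i k * G k j)
        = (\<Sum>k\<in>insert v F. (if k = v then 0 else g i k) * G k j - r i / N * (p k * G k j))"
      by (intro sum.cong refl) (simp add: g'_def False algebra_simps)
    also have "\<dots> = (\<Sum>k\<in>insert v F. (if k = v then 0 else g i k) * G k j)
        - r i / N * (\<Sum>k\<in>insert v F. p k * G k j)"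
      by (simp only: sum_subtractf sum_distrib_left)
    also have "(\<Sum>k\<in>insert v F. (if k = v then 0 else g i k) * G k j) = (\<Sum>k\<in>F. g i k * G k j)"
      using insert.hyps vF by (auto intro!: sum.cong)
    finally show ?thesis
      using that N p0 False vF i g by (cases "j = v") (auto simp: N_def[symmetric] r_def)
  qed
  then show ?case by blast
qed

text \<open>The residual at the Fourier coefficients is orthogonal to every \<open>\<phi> i\<close>,
  and any other residual differs from it by a combination of these; Pythagoras does the rest. Thus
  any good approximation from the span bounds the projection error.\<close>

lemma L2_projection_best:
  assumes "finite I" and "\<And>i. i \<in> I \<Longrightarrow> square_integrable M (\<phi> i)" and e: "square_integrable M e"
    and "\<And>i j. i \<in> I \<Longrightarrow> j \<in> I \<Longrightarrow> L2_inner M (\<phi> i) (\<phi> j) = of_bool (i = j)"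
  defines "d \<equiv> \<lambda>c x. e x - (\<Sum>i\<in>I. c i * \<phi> i x)"
  shows "L2_inner M (d (\<lambda>i. L2_inner M e (\<phi> i))) (d (\<lambda>i. L2_inner M e (\<phi> i))) \<le> L2_inner M (d c) (d c)"
proof -
  let ?a = "\<lambda>i. L2_inner M e (\<phi> i)"
  have sd: "square_integrable M (d c)" for c
    unfolding d_def using assms(2) e by (intro square_integrable_diff square_integrable_lincomb)
  let ?w = "\<lambda>x. \<Sum>i\<in>I. (?a i - c i) * \<phi> i x"
  have w: "square_integrable M ?w" using assms by auto
  have orth: "L2_inner M (d ?a) (\<phi> j) = 0" if "j \<in> I" for j
  proof -
    have "L2_inner M (d ?a) (\<phi> j) = L2_inner M e (\<phi> j) - (\<Sum>i\<in>I. ?a i * L2_inner M (\<phi> i) (\<phi> j))"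
      unfolding d_def using assms that
      by (subst L2_inner_diff_left) (auto simp: L2_inner_sum_left)
    also have "(\<Sum>i\<in>I. ?a i * L2_inner M (\<phi> i) (\<phi> j)) = (\<Sum>i\<in>I. if i = j then ?a j else 0)"
      using assms that by (intro sum.cong) auto
    finally show ?thesis using assms that by simp
  qed
  have cross: "L2_inner M (d ?a) ?w = 0"
    using assms sd orth by (subst L2_inner_sum_right) auto
  have "d c = (\<lambda>x. d ?a x + ?w x)"
    by (simp add: d_def left_diff_distrib sum_subtractf)
  then have "L2_inner M (d c) (d c) = L2_inner M (d ?a) (d ?a) + L2_inner M ?w ?w"
    using cross sd[of ?a] w L2_inner_commute[of M ?w "d ?a"]
    by (simp add: L2_inner_add_left L2_inner_add_right square_integrable_add)
  then show ?thesis using L2_inner_nonneg[of M ?w] by simp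
qed

text \<open>
  The trace of the product of the orthogonal projections onto the spans of \<open>e\<close> and of \<open>\<phi>\<close>,
  estimated from below through the basis dual to \<open>e\<close> and from above through \<open>\<phi>\<close>.
\<close>

lemma card_le_of_concentration:
  assumes F: "finite F" and e: "\<And>i. i \<in> F \<Longrightarrow> square_integrable M (e i)"
    and C: "0 < C" and riesz: "\<And>c. (\<Sum>i\<in>F. (c i)\<^sup>2)
      \<le> C * L2_inner M (\<lambda>x. \<Sum>i\<in>F. c i * e i x) (\<lambda>x. \<Sum>i\<in>F. c i * e i x)"
    and I: "finite I" and \<phi>: "\<And>i. i \<in> I \<Longrightarrow> square_integrable M (\<phi> i)"
    and orth: "\<And>i j. i \<in> I \<Longrightarrow> j \<in> I \<Longrightarrow> L2_inner M (\<phi> i) (\<phi> j) = of_bool (i = j)"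
    and \<psi>: "\<And>i. i \<in> I \<Longrightarrow> square_integrable M (\<psi> i)"
    and e\<psi>: "\<And>k i. k \<in> F \<Longrightarrow> i \<in> I \<Longrightarrow> L2_inner M (e k) (\<phi> i) = L2_inner M (e k) (\<psi> i)"
    and approx: "\<And>k. k \<in> F \<Longrightarrow> \<exists>c. L2_inner M (\<lambda>x. e k x - (\<Sum>i\<in>I. c i * \<phi> i x))
         (\<lambda>x. e k x - (\<Sum>i\<in>I. c i * \<phi> i x)) \<le> \<epsilon>\<^sup>2"
    and \<epsilon>: "0 \<le> \<epsilon>"
  shows "real (card F) * (1 - \<epsilon> * sqrt C) \<le> (\<Sum>i\<in>I. L2_inner M (\<psi> i) (\<psi> i))"
proof -
  define G where "G i j = L2_inner M (e i) (e j)" for i j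
  have expand: "L2_inner M (\<lambda>x. \<Sum>i\<in>F. c i * e i x) (\<lambda>x. \<Sum>i\<in>F. c i * e i x)
      = (\<Sum>i\<in>F. \<Sum>j\<in>F. c i * c j * G i j)" for c
    using e by (simp add: L2_inner_sum_left L2_inner_sum_right square_integrable_lincomb G_def
        sum_distrib_left mult.assoc)
  have "\<exists>g. \<forall>i\<in>F. \<forall>j\<in>F. (\<Sum>k\<in>F. g i k * G k j) = of_bool (i = j)"
  proof (rule gram_inverse_exists[OF F])
    fix c :: "'a \<Rightarrow> real" assume "\<exists>i\<in>F. c i \<noteq> 0"
    then have "0 < (\<Sum>i\<in>F. (c i)\<^sup>2)" using F by (auto intro!: sum_pos2)
    then have "0 < C * (\<Sum>i\<in>F. \<Sum>j\<in>F. c i * c j * G i j)"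
      using riesz[of c] unfolding expand by linarith
    then show "0 < (\<Sum>i\<in>F. \<Sum>j\<in>F. c i * c j * G i j)"
      using C by (simp add: zero_less_mult_iff)
  qed (simp add: G_def L2_inner_commute)
  then obtain g where g: "\<And>i j. i \<in> F \<Longrightarrow> j \<in> F \<Longrightarrow> (\<Sum>k\<in>F. g i k * G k j) = of_bool (i = j)"
    by blast
  \<comment> \<open>The basis dual to \<open>e\<close>, taken inside the span of
    \<open>e\<close>.\<close>
  define h where "h i x = (\<Sum>k\<in>F. g i k * e k x)" for i x
  have h: "square_integrable M (h i)" for i
    unfolding h_def using e by auto
  have he: "L2_inner M (h i) (e j) = of_bool (i = j)" if "i \<in> F" "j \<in> F" for i j
    unfolding h_def using e that g by (simp add: L2_inner_sum_left G_def)
  have hh: "L2_inner M (h i) (h i) = g i i" if "i \<in> F" for i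
  proof -
    have "L2_inner M (h i) (h i) = (\<Sum>k\<in>F. g i k * L2_inner M (h i) (e k))"
      unfolding h_def[of i, abs_def] using e h[of i, unfolded h_def[abs_def]] by (rule L2_inner_sum_right)
    also have "\<dots> = (\<Sum>k\<in>F. if k = i then g i i else 0)"
      using that by (intro sum.cong) (auto simp: he)
    finally show ?thesis using F that by simp
  qed
  \<comment> \<open>The Riesz bound tested on \<open>h i\<close> itself: the squared norm
    \<open>g i i\<close> is also one of the coefficients of \<open>h i\<close>.\<close>
  have gC: "g i i \<le> C" if "i \<in> F" for i
  proof -
    have "(g i i)\<^sup>2 \<le> (\<Sum>k\<in>F. (g i k)\<^sup>2)"
      using F that by (intro member_le_sum) auto
    also have "\<dots> \<le> C * g i i"
      using riesz[of "g i"] hh[OF that] by (simp add: h_def[abs_def])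
    finally have "g i i * g i i \<le> C * g i i" by (simp add: power2_eq_square)
    then show ?thesis
      using C hh[OF that] L2_inner_nonneg[of M "h i"] by (cases "g i i = 0") auto
  qed
  define a where "a k i = L2_inner M (e k) (\<phi> i)" for k i
  define d where "d k x = e k x - (\<Sum>i\<in>I. a k i * \<phi> i x)" for k x
  have d: "square_integrable M (d k)" if "k \<in> F" for k
    unfolding d_def using e[OF that] \<phi> by (intro square_integrable_diff square_integrable_lincomb)
  have dd: "sqrt (L2_inner M (d k) (d k)) \<le> \<epsilon>" if "k \<in> F" for k
  proof -
    from approx[OF that] obtain c where c: "L2_inner M (\<lambda>x. e k x - (\<Sum>i\<in>I. c i * \<phi> i x))
         (\<lambda>x. e k x - (\<Sum>i\<in>I. c i * \<phi> i x)) \<le> \<epsilon>\<^sup>2"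
      by blast
    have "L2_inner M (d k) (d k) \<le> L2_inner M (\<lambda>x. e k x - (\<Sum>i\<in>I. c i * \<phi> i x))
         (\<lambda>x. e k x - (\<Sum>i\<in>I. c i * \<phi> i x))"
      using L2_projection_best[OF I \<phi> e[OF that] orth, of c] by (simp add: d_def[abs_def] a_def)
    then show ?thesis using c \<epsilon> real_le_lsqrt by fastforce
  qed
  \<comment> \<open>The squared norm of the projection of \<open>\<phi> i\<close> onto the span of
    \<open>e\<close>; the sum over \<open>I\<close> is the trace.\<close>
  define q where "q i = (\<Sum>k\<in>F. \<Sum>l\<in>F. a k i * g k l * a l i)" for i
  have qle: "q i \<le> L2_inner M (\<psi> i) (\<psi> i)" if "i \<in> I" for i
  proof -
    \<comment> \<open>This is that projection, written in the dual basis. It lies in the span of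
      \<open>e\<close> and so pairs equally with \<open>\<phi> i\<close> and
      \<open>\<psi> i\<close>; hence its norm is at most that of \<open>\<psi> i\<close>.\<close>
    define Q where "Q x = (\<Sum>k\<in>F. a k i * h k x)" for x
    have Q: "square_integrable M Q" unfolding Q_def using h by auto
    have Qe: "L2_inner M Q (e l) = a l i" if "l \<in> F" for l
    proof -
      have "L2_inner M Q (e l) = (\<Sum>k\<in>F. if k = l then a l i else 0)"
        unfolding Q_def using that h e he by (subst L2_inner_sum_left) (auto intro!: sum.cong)
      then show ?thesis using F that by simp
    qed
    have Qh: "L2_inner M Q (h k) = (\<Sum>l\<in>F. g k l * a l i)" for k
      unfolding h_def using e Q Qe by (simp add: L2_inner_sum_right)
    have "L2_inner M Q (\<lambda>x. \<Sum>k\<in>F. a k i * h k x) = q i"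
      using h Q by (simp add: L2_inner_sum_right Qh q_def sum_distrib_left mult.assoc)
    then have QQ: "L2_inner M Q Q = q i" by (simp add: Q_def[abs_def])
    have hf: "L2_inner M (h k) f = (\<Sum>l\<in>F. g k l * L2_inner M (e l) f)"
      if "square_integrable M f" for f k
      unfolding h_def using that e by (simp add: L2_inner_sum_left)
    have "L2_inner M Q (\<psi> i) = (\<Sum>k\<in>F. a k i * (\<Sum>l\<in>F. g k l * L2_inner M (e l) (\<psi> i)))"
      unfolding Q_def using h \<psi>[OF \<open>i \<in> I\<close>] by (simp add: L2_inner_sum_left hf)
    also have "\<dots> = q i"
      using that by (simp add: q_def sum_distrib_left mult.assoc a_def e\<psi>)
    finally have "(q i)\<^sup>2 \<le> q i * L2_inner M (\<psi> i) (\<psi> i)"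
      using L2_Cauchy_Schwarz[OF Q \<psi>[OF that]] QQ by simp
    then have "q i * q i \<le> q i * L2_inner M (\<psi> i) (\<psi> i)" by (simp add: power2_eq_square)
    then show ?thesis
      using L2_inner_nonneg[of M Q] L2_inner_nonneg[of M "\<psi> i"] QQ by (cases "q i = 0") auto
  qed
  \<comment> \<open>A diagonal entry of the trace: the pairing of \<open>e k\<close> with
    \<open>h k\<close> is 1, and replacing \<open>e k\<close> by its projection onto the span of
    \<open>\<phi>\<close> costs at most \<open>\<epsilon>\<close> times the norm of
    \<open>h k\<close>.\<close>
  have one: "1 \<le> (\<Sum>i\<in>I. \<Sum>l\<in>F. a k i * g k l * a l i) + \<epsilon> * sqrt C" if k: "k \<in> F" for k
  proof -
    have P: "square_integrable M (\<lambda>x. \<Sum>i\<in>I. a k i * \<phi> i x)" using \<phi> by auto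
    have "1 = L2_inner M (e k) (h k)" using he[OF k k] by (simp add: L2_inner_commute)
    also have "e k = (\<lambda>x. (\<Sum>i\<in>I. a k i * \<phi> i x) + d k x)" by (simp add: d_def)
    also have "L2_inner M \<dots> (h k) = L2_inner M (\<lambda>x. \<Sum>i\<in>I. a k i * \<phi> i x) (h k) + L2_inner M (d k) (h k)"
      by (intro L2_inner_add_left P d k h)
    also have "L2_inner M (\<lambda>x. \<Sum>i\<in>I. a k i * \<phi> i x) (h k) = (\<Sum>i\<in>I. a k i * L2_inner M (\<phi> i) (h k))"
      using \<phi> h by (simp add: L2_inner_sum_left)
    also have "\<dots> = (\<Sum>i\<in>I. \<Sum>l\<in>F. a k i * g k l * a l i)"
    proof (intro sum.cong refl)
      fix i assume "i \<in> I"
      have "L2_inner M (\<phi> i) (h k) = (\<Sum>l\<in>F. g k l * a l i)"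
        unfolding h_def using e \<phi>[OF \<open>i \<in> I\<close>]
        by (simp add: L2_inner_sum_right) (simp add: a_def L2_inner_commute)
      then show "a k i * L2_inner M (\<phi> i) (h k) = (\<Sum>l\<in>F. a k i * g k l * a l i)"
        by (simp add: sum_distrib_left mult.assoc)
    qed
    also have "L2_inner M (d k) (h k) \<le> sqrt (L2_inner M (d k) (d k)) * sqrt (L2_inner M (h k) (h k))"
      using L2_inner_le[OF d[OF k] h[of k]] by linarith
    also have "\<dots> \<le> \<epsilon> * sqrt C"
      using dd[OF k] gC[OF k] hh[OF k] \<epsilon> L2_inner_nonneg[of M "h k"] by (intro mult_mono) auto
    finally show ?thesis by simp
  qed
  have "real (card F) = (\<Sum>k\<in>F. 1)" by simp
  also have "\<dots> \<le> (\<Sum>k\<in>F. (\<Sum>i\<in>I. \<Sum>l\<in>F. a k i * g k l * a l i) + \<epsilon> * sqrt C)"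
    by (intro sum_mono one)
  also have "\<dots> = (\<Sum>i\<in>I. q i) + real (card F) * (\<epsilon> * sqrt C)"
    unfolding q_def by (subst (2) sum.swap) (simp add: sum.distrib)
  also have "\<dots> \<le> (\<Sum>i\<in>I. L2_inner M (\<psi> i) (\<psi> i)) + real (card F) * (\<epsilon> * sqrt C)"
    by (intro add_right_mono sum_mono qle)
  finally show ?thesis by (simp add: algebra_simps)
qed

section \<open>From interpolation to a Riesz sequence\<close>

text \<open>
  A gliding hump: normalised combinations \<open>u m\<close> whose images shrink like \<open>4\<^sup>-\<^sup>m\<close> are summed with
  weights \<open>3\<^sup>-\<^sup>m\<close> and with signs chosen so that no cancellation occurs in the pairing with \<open>u m\<close>.
\<close>

lemma riesz_lower_bound_of_moment_problem:
  fixes e :: "nat \<Rightarrow> 'a \<Rightarrow> real"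
  assumes e: "\<And>n. square_integrable M (e n)"
    and moment: "\<And>a. summable (\<lambda>n. (a n)\<^sup>2) \<Longrightarrow>
      \<exists>g. square_integrable M g \<and> (\<forall>n. L2_inner M (e n) g = a n)"
  shows "\<exists>C>0. \<forall>F c. finite F \<longrightarrow> (\<Sum>i\<in>F. (c i)\<^sup>2)
    \<le> C * L2_inner M (\<lambda>x. \<Sum>i\<in>F. c i * e i x) (\<lambda>x. \<Sum>i\<in>F. c i * e i x)"
proof (rule ccontr)
  define Q where "Q F c = L2_inner M (\<lambda>x. \<Sum>i\<in>F. c i * e i x) (\<lambda>x. \<Sum>i\<in>F. c i * e i x)" for F c
  assume "\<not> ?thesis"
  then have neg: "\<exists>F c. finite F \<and> C * Q F c < (\<Sum>i\<in>F. (c i)\<^sup>2)" if "0 < C" for C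
    using that by (auto simp: Q_def not_le)
  have "\<exists>F u. finite F \<and> (\<forall>n. n \<notin> F \<longrightarrow> u n = 0) \<and> (\<Sum>n\<in>F. (u n)\<^sup>2) = 1 \<and> sqrt (Q F u) \<le> (1/4) ^ m"
    for m :: nat
  proof -
    \<comment> \<open>The base is 16 because \<open>Q\<close> is a squared norm, whose root must
      decay like \<open>(1/4) ^ m\<close>.\<close>
    obtain F c where F: "finite F" and less: "16 ^ m * Q F c < (\<Sum>i\<in>F. (c i)\<^sup>2)"
      using neg[of "16 ^ m"] by auto
    define s where "s = (\<Sum>i\<in>F. (c i)\<^sup>2)"
    have s: "0 < s"
      using less L2_inner_nonneg[of M "\<lambda>x. \<Sum>i\<in>F. c i * e i x"]
      by (simp add: s_def Q_def) (smt (verit) mult_nonneg_nonneg zero_le_power)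
    define u where "u n = (if n \<in> F then 1 / sqrt s * c n else 0)" for n
    have "Q F u = Q F (\<lambda>n. 1 / sqrt s * c n)"
      by (simp add: Q_def u_def cong: sum.cong)
    also have "\<dots> = Q F c / s"
      using s by (simp add: Q_def mult.assoc sum_distrib_left[symmetric] sum_divide_distrib[symmetric]
          L2_inner_def mult.commute)
    finally have "Q F u = Q F c / s" .
    moreover have "Q F c / s \<le> (1 / 16) ^ m"
      using less s by (simp add: s_def field_simps)
    ultimately have "sqrt (Q F u) \<le> sqrt ((1 / 16) ^ m)" by simp
    also have "sqrt ((1 / 16) ^ m) = (1/4) ^ m"
    proof (rule real_sqrt_unique)
      show "((1 / 4) ^ m)\<^sup>2 = (1 / 16 :: real) ^ m"
        by (simp add: power_mult[symmetric] mult.commute[of m]) (simp add: power_mult power2_eq_square)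
    qed simp
    finally have "sqrt (Q F u) \<le> (1/4) ^ m" .
    moreover have "(\<Sum>n\<in>F. (u n)\<^sup>2) = (\<Sum>n\<in>F. (c n)\<^sup>2 / s)"
      using s by (intro sum.cong) (auto simp: u_def power_mult_distrib power_divide)
    then have "(\<Sum>n\<in>F. (u n)\<^sup>2) = 1"
      using s by (simp add: sum_divide_distrib[symmetric] s_def)
    ultimately show ?thesis using F by (intro exI[of _ F] exI[of _ u]) (auto simp: u_def)
  qed
  then have "\<forall>m. \<exists>p. finite (fst p) \<and> (\<forall>n. n \<notin> fst p \<longrightarrow> snd p n = 0) \<and>
      (\<Sum>n\<in>fst p. (snd p n)\<^sup>2) = 1 \<and> sqrt (Q (fst p) (snd p)) \<le> (1/4) ^ m"
    by simp
  then obtain p where p: "\<And>m. finite (fst (p m)) \<and> (\<forall>n. n \<notin> fst (p m) \<longrightarrow> snd (p m) n = 0) \<and>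
      (\<Sum>n\<in>fst (p m). (snd (p m) n)\<^sup>2) = 1 \<and> sqrt (Q (fst (p m)) (snd (p m))) \<le> (1/4) ^ m"
    by metis
  define F where "F m = fst (p m)" for m
  define u where "u m = snd (p m)" for m
  have F: "finite (F m)" and supp: "n \<notin> F m \<Longrightarrow> u m n = 0" and unit: "(\<Sum>n\<in>F m. (u m n)\<^sup>2) = 1"
    and small: "sqrt (Q (F m) (u m)) \<le> (1/4) ^ m" for m n
    using p[of m] by (auto simp: F_def u_def)
  have u_norm: "(\<Sum>n\<in>K. (u m n)\<^sup>2) \<le> 1" if "finite K" for K m
  proof -
    have "(\<Sum>n\<in>K. (u m n)\<^sup>2) = (\<Sum>n\<in>K \<inter> F m. (u m n)\<^sup>2)"
      using that supp by (intro sum.mono_neutral_right) auto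
    also have "\<dots> \<le> (\<Sum>n\<in>F m. (u m n)\<^sup>2)"
      using F by (intro sum_mono2) auto
    finally show ?thesis using unit by simp
  qed
  have u_le: "\<bar>u m n\<bar> \<le> 1" for m n
    using u_norm[of "{n}" m] by (simp add: abs_square_le_1)
  \<comment> \<open>The sign of the pairing with the current partial sum, so that the new hump
    pushes the pairing away from zero. A vanishing pairing must also receive a genuine sign, here
    1.\<close>
  define s :: "nat \<Rightarrow> (nat \<Rightarrow> real) \<Rightarrow> real"
    where "s m y = (if 0 \<le> (\<Sum>n\<in>F m. u m n * y n) then 1 else -1)" for m y
  define x where "x = rec_nat (\<lambda>n. 0) (\<lambda>m y n. y n + s m y * (1/3) ^ m * u m n)"
  have x0: "x 0 n = 0" and xSuc: "x (Suc m) n = x m n + s m (x m) * (1/3) ^ m * u m n" for m n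
    by (simp_all add: x_def)
  have s_abs: "\<bar>s m y\<bar> = 1" for m y by (simp add: s_def)
  define b where "b n j = s j (x j) * (1/3) ^ j * u j n" for n j
  have x_sum: "x N n = (\<Sum>j<N. b n j)" for N n
    by (induction N) (simp_all add: x0 xSuc b_def)
  have b_le: "norm (b n j) \<le> (1/3) ^ j" for n j
    using u_le[of j n] s_abs[of j "x j"] by (simp add: b_def abs_mult)
  have "summable (b n)" for n
    by (rule summable_comparison_test'[of "\<lambda>j. (1/3) ^ j" 0]) (simp, rule b_le)
  then have x_lim: "(\<lambda>N. x N n) \<longlonglongrightarrow> suminf (b n)" for n
    by (simp add: x_sum summable_LIMSEQ)
  define a where "a n = suminf (b n)" for n
  \<comment> \<open>The bound is the geometric sum of the weights \<open>(1/3) ^ j\<close> over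
    \<open>j < N\<close>.\<close>
  have x_norm: "L2_set (x N) K \<le> 3/2 * (1 - (1/3) ^ N)" if "finite K" for N K
  proof (induction N)
    case 0
    then show ?case by (simp add: x0 L2_set_def)
  next
    case (Suc N)
    have "L2_set (x (Suc N)) K \<le> L2_set (x N) K + L2_set (\<lambda>n. s N (x N) * (1/3) ^ N * u N n) K"
      unfolding xSuc by (rule L2_set_triangle_ineq)
    also have "L2_set (\<lambda>n. s N (x N) * (1/3) ^ N * u N n) K = (1/3) ^ N * L2_set (u N) K"
      using s_abs[of N "x N"]
      by (simp add: L2_set_def power_mult_distrib sum_distrib_left[symmetric] real_sqrt_mult abs_mult)
    also have "\<dots> \<le> (1/3) ^ N * 1"
      using u_norm[OF that, of N] by (intro mult_left_mono) (auto simp: L2_set_def)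
    finally show ?case using Suc.IH by simp
  qed
  have "(\<Sum>n\<in>K. (a n)\<^sup>2) \<le> 4" if "finite K" for K
  proof (rule LIMSEQ_le_const2)
    show "(\<lambda>N. \<Sum>n\<in>K. (x N n)\<^sup>2) \<longlonglongrightarrow> (\<Sum>n\<in>K. (a n)\<^sup>2)"
      unfolding a_def by (intro tendsto_sum tendsto_power x_lim)
    have "L2_set (x N) K \<le> 2" for N
    proof -
      have "l \<le> 2" if "l \<le> 3/2 * (1 - y)" "0 \<le> y" for l y :: real
        using that by (simp add: right_diff_distrib)
      from this[OF x_norm[OF \<open>finite K\<close>]] show ?thesis by simp
    qed
    then have "sqrt (\<Sum>n\<in>K. (x N n)\<^sup>2) \<le> sqrt 4" for N by (simp add: L2_set_def)
    then have "(\<Sum>n\<in>K. (x N n)\<^sup>2) \<le> 4" for N by (simp only: real_sqrt_le_iff)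
    then show "\<exists>N. \<forall>n\<ge>N. (\<Sum>i\<in>K. (x n i)\<^sup>2) \<le> 4" by blast
  qed
  then have "summable (\<lambda>n. (a n)\<^sup>2)"
    by (intro summableI_nonneg_bounded[of _ 4]) auto
  from moment[OF this] obtain g where g: "square_integrable M g" and ga: "\<And>n. L2_inner M (e n) g = a n"
    by blast
  have uu: "\<bar>\<Sum>n\<in>F m. u m n * u N n\<bar> \<le> 1" for m N
  proof -
    have "(\<Sum>n\<in>F m. u m n * u N n)\<^sup>2 \<le> (\<Sum>n\<in>F m. (u m n)\<^sup>2) * (\<Sum>n\<in>F m. (u N n)\<^sup>2)"
      by (rule Cauchy_Schwarz_ineq_sum)
    also have "\<dots> \<le> 1" using u_norm[OF F] unit by simp
    finally show ?thesis by (simp add: abs_square_le_1)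
  qed
  have pair_Suc: "(\<Sum>n\<in>F m. u m n * x (Suc N) n)
      = (\<Sum>n\<in>F m. u m n * x N n) + s N (x N) * (1/3) ^ N * (\<Sum>n\<in>F m. u m n * u N n)" for m N
    by (simp add: xSuc distrib_left sum.distrib sum_distrib_left mult_ac)
  \<comment> \<open>The hump \<open>m\<close> brings the pairing to at least
    \<open>(1/3) ^ m\<close>. The later ones up to \<open>k\<close> take away at most the sum of
    their weights, \<open>((1/3) ^ m - (1/3) ^ k) / 2\<close>; with ratio 1/3 half of the hump
    always survives.\<close>
  have hump: "((1/3) ^ m + (1/3) ^ k) / 2 \<le> \<bar>\<Sum>n\<in>F m. u m n * x (Suc k) n\<bar>" if "m \<le> k" for m k
    using that
  proof (induction k rule: dec_induct)
    case base
    have "(\<Sum>n\<in>F m. u m n * u m n) = 1" using unit[of m] by (simp add: power2_eq_square)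
    then show ?case unfolding pair_Suc by (auto simp: s_def)
  next
    case (step k)
    have "\<bar>s (Suc k) (x (Suc k)) * (1/3) ^ Suc k * (\<Sum>n\<in>F m. u m n * u (Suc k) n)\<bar> \<le> (1/3) ^ Suc k"
      using uu[of m "Suc k"] s_abs[of "Suc k" "x (Suc k)"] by (simp add: abs_mult)
    moreover have "(a + y) / 2 \<le> \<bar>p + q\<bar>" if "\<bar>q\<bar> \<le> y" "(a + 3 * y) / 2 \<le> \<bar>p\<bar>" for a p q y :: real
      using that abs_triangle_ineq2[of p "- q"] by (simp add: field_simps)
    moreover have "((1/3) ^ m + 3 * (1/3) ^ Suc k) / 2 \<le> \<bar>\<Sum>n\<in>F m. u m n * x (Suc k) n\<bar>"
      using step.IH by simp
    ultimately show ?case unfolding pair_Suc[of m "Suc k"] by blast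
  qed
  have "(1/3) ^ m / 2 \<le> \<bar>\<Sum>n\<in>F m. u m n * a n\<bar>" for m
  proof (rule LIMSEQ_le_const)
    show "(\<lambda>N. \<bar>\<Sum>n\<in>F m. u m n * x N n\<bar>) \<longlonglongrightarrow> \<bar>\<Sum>n\<in>F m. u m n * a n\<bar>"
      unfolding a_def by (intro tendsto_rabs tendsto_sum tendsto_mult tendsto_const x_lim)
    have "(1/3) ^ m / 2 \<le> \<bar>\<Sum>n\<in>F m. u m n * x N n\<bar>" if "Suc m \<le> N" for N
      using that hump[of m "N - 1"] by (cases N) (auto intro: order_trans[rotated])
    then show "\<exists>N. \<forall>n\<ge>N. (1/3) ^ m / 2 \<le> \<bar>\<Sum>k\<in>F m. u m k * x n k\<bar>" by blast
  qed
  moreover have "\<bar>\<Sum>n\<in>F m. u m n * a n\<bar> \<le> (1/4) ^ m * sqrt (L2_inner M g g)" for m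
  proof -
    have "(\<Sum>n\<in>F m. u m n * a n) = L2_inner M (\<lambda>x. \<Sum>n\<in>F m. u m n * e n x) g"
      using e g by (simp add: L2_inner_sum_left ga)
    also have "\<bar>\<dots>\<bar> \<le> sqrt (Q (F m) (u m)) * sqrt (L2_inner M g g)"
      unfolding Q_def using e g by (intro L2_inner_le square_integrable_lincomb)
    also have "\<dots> \<le> (1/4) ^ m * sqrt (L2_inner M g g)"
      using small[of m] by (intro mult_right_mono) (auto simp: L2_inner_nonneg)
    finally show ?thesis .
  qed
  ultimately have "(1/3) ^ m / 2 \<le> (1/4) ^ m * sqrt (L2_inner M g g)" for m
    using order_trans by blast
  then have "(4/3) ^ m \<le> 2 * sqrt (L2_inner M g g)" for m
    by (simp add: power_divide field_simps)
  moreover obtain m where "2 * sqrt (L2_inner M g g) < (4/3) ^ m"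
    using real_arch_pow[of "4/3" "2 * sqrt (L2_inner M g g)"] by auto
  ultimately show False by (metis not_le)
qed

section \<open>Asymptotics of the Bessel kernel\<close>

text \<open>The function \<open>p u + K / u\<close> is non-increasing and \<open>p u - K / u\<close>
  is non-decreasing. The second bounds the first from below, so the first converges to its infimum,
  and \<open>K / u\<close> tends to 0.\<close>

lemma tendsto_at_top_of_derivative_bound:
  fixes p p' :: "real \<Rightarrow> real"
  assumes der: "\<And>u. 1 \<le> u \<Longrightarrow> (p has_real_derivative p' u) (at u)"
    and bound: "\<And>u. 1 \<le> u \<Longrightarrow> \<bar>p' u\<bar> \<le> K / u\<^sup>2"
  shows "\<exists>P. (p \<longlongrightarrow> P) at_top"
proof -
  define q where "q u = p u + K / u" for u
  define r where "r u = p u - K / u" for u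
  have K: "0 \<le> K" using bound[of 1] by (simp add: order_trans[OF abs_ge_zero])
  have q_antimono: "q y \<le> q x" if "1 \<le> x" "x \<le> y" for x y
  proof (rule DERIV_nonpos_imp_nonincreasing[OF \<open>x \<le> y\<close>])
    fix u assume u: "x \<le> u" "u \<le> y"
    then have "(q has_real_derivative p' u - K / u\<^sup>2) (at u)"
      unfolding q_def using that
      by (auto intro!: derivative_eq_intros der simp: power2_eq_square)
    then show "\<exists>D. (q has_real_derivative D) (at u) \<and> D \<le> 0"
      using bound[of u] u that by (intro exI[of _ "p' u - K / u\<^sup>2"]) auto
  qed
  have r_mono: "r x \<le> r y" if "1 \<le> x" "x \<le> y" for x y
  proof (rule DERIV_nonneg_imp_nondecreasing[OF \<open>x \<le> y\<close>])
    fix u assume u: "x \<le> u" "u \<le> y"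
    then have "(r has_real_derivative p' u + K / u\<^sup>2) (at u)"
      unfolding r_def using that
      by (auto intro!: derivative_eq_intros der simp: power2_eq_square)
    then show "\<exists>D. (r has_real_derivative D) (at u) \<and> 0 \<le> D"
      using bound[of u] u that by (intro exI[of _ "p' u + K / u\<^sup>2"]) auto
  qed
  have lower: "r 1 \<le> q u" if "1 \<le> u" for u
  proof -
    have "r u \<le> q u" using K that by (simp add: q_def r_def)
    then show ?thesis using r_mono[of 1 u] that by simp
  qed
  define P where "P = Inf (q ` {1..})"
  have bdd: "bdd_below (q ` {1..})" using lower by (auto intro!: bdd_belowI[of _ "r 1"])
  have "(q \<longlongrightarrow> P) at_top"
  proof (rule order_tendstoI)
    fix a assume "a < P"
    moreover have "P \<le> q u" if "1 \<le> u" for u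
      unfolding P_def using bdd that by (auto intro!: cInf_lower)
    ultimately show "\<forall>\<^sub>F u in at_top. a < q u"
      by (auto intro!: eventually_mono[OF eventually_ge_at_top[of 1]] intro: less_le_trans)
  next
    fix a assume "P < a"
    then obtain u0 where "1 \<le> u0" "q u0 < a"
      unfolding P_def using cInf_lessD[of "q ` {1..}" a] by auto
    then show "\<forall>\<^sub>F u in at_top. q u < a"
      by (auto intro!: eventually_mono[OF eventually_ge_at_top[of u0]] intro: le_less_trans q_antimono)
  qed
  moreover have "((\<lambda>u. K / u) \<longlongrightarrow> 0) at_top"
    by (intro tendsto_divide_0[OF tendsto_const] filterlim_at_top_imp_at_infinity filterlim_ident)
  ultimately have "((\<lambda>u. q u - K / u) \<longlongrightarrow> P - 0) at_top"
    by (rule tendsto_diff)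
  then show ?thesis by (auto simp: q_def)
qed

text \<open>
  The energy \<open>f\<^sup>2 + f'\<^sup>2\<close> stays bounded, so by variation of constants the coordinates of \<open>(f, f')\<close>
  in the rotating frame of the unperturbed equation \<open>f'' = - f\<close> converge.
\<close>

lemma oscillator_asymptotics:
  fixes f f' :: "real \<Rightarrow> real"
  assumes f: "\<And>u. 1 \<le> u \<Longrightarrow> (f has_real_derivative f' u) (at u)"
    and f': "\<And>u. 1 \<le> u \<Longrightarrow> (f' has_real_derivative (c / u\<^sup>2 - 1) * f u) (at u)"
  shows "\<exists>m. \<forall>u\<ge>1. \<bar>f u\<bar> \<le> m"
    and "\<exists>A B. ((\<lambda>u. f u - (A * sin u + B * cos u)) \<longlongrightarrow> 0) at_top"
proof -
  define E where "E u = (f u)\<^sup>2 + (f' u)\<^sup>2" for u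
  \<comment> \<open>The derivative of \<open>E\<close> is \<open>2 * c * f u * f' u / u^2\<close>,
    at most \<open>\<bar>c\<bar> * E u / u^2\<close> in absolute value. The exponential has
    logarithmic derivative \<open>- \<bar>c\<bar> / u^2\<close> and compensates this growth.\<close>
  define g where "g u = E u * exp (\<bar>c\<bar> / u)" for u
  have g_antimono: "g u \<le> g 1" if "1 \<le> u" for u
  proof (rule DERIV_nonpos_imp_nonincreasing[OF that])
    fix x assume x: "1 \<le> x" "x \<le> u"
    let ?D = "exp (\<bar>c\<bar> / x) / x\<^sup>2 * (2 * c * f x * f' x - \<bar>c\<bar> * E x)"
    have "(g has_real_derivative ?D) (at x)"
      unfolding g_def E_def using x
      by (auto intro!: derivative_eq_intros f f' simp: field_simps power2_eq_square)
    moreover have "?D \<le> 0"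
    proof -
      have "2 * c * f x * f' x \<le> \<bar>c\<bar> * (2 * \<bar>f x\<bar> * \<bar>f' x\<bar>)"
        by (simp add: abs_mult[symmetric])
      also have "\<dots> \<le> \<bar>c\<bar> * E x"
        using sum_squares_bound[of "\<bar>f x\<bar>" "\<bar>f' x\<bar>"] by (intro mult_left_mono) (auto simp: E_def)
      finally show ?thesis by (simp add: mult_le_0_iff divide_le_0_iff)
    qed
    ultimately show "\<exists>D. (g has_real_derivative D) (at x) \<and> D \<le> 0" by blast
  qed
  define m where "m = sqrt (g 1)"
  have m: "\<bar>f u\<bar> \<le> m" if "1 \<le> u" for u
  proof -
    have "(f u)\<^sup>2 \<le> E u * 1" by (simp add: E_def)
    also have "\<dots> \<le> g u" unfolding g_def using that by (intro mult_left_mono) (auto simp: E_def)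
    also have "\<dots> \<le> g 1" by (rule g_antimono[OF that])
    finally show ?thesis unfolding m_def by (intro real_le_rsqrt) simp
  qed
  then show "\<exists>m. \<forall>u\<ge>1. \<bar>f u\<bar> \<le> m" by blast
  have bound: "\<bar>c / u\<^sup>2 * f u * s\<bar> \<le> \<bar>c\<bar> * m / u\<^sup>2" if "1 \<le> u" "\<bar>s\<bar> \<le> 1" for u s
  proof -
    have "\<bar>c / u\<^sup>2 * f u * s\<bar> = \<bar>c\<bar> / u\<^sup>2 * (\<bar>f u\<bar> * \<bar>s\<bar>)" by (simp add: abs_mult)
    also have "\<dots> \<le> \<bar>c\<bar> / u\<^sup>2 * (m * 1)"
      using m[OF that(1)] that by (intro mult_left_mono mult_mono) auto
    finally show ?thesis by simp
  qed
  \<comment> \<open>Rotation by the angle \<open>u\<close> cancels the unperturbed motion: the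
    derivatives of \<open>p\<close> and \<open>r\<close> keep only \<open>c / u^2 * f u\<close>
    times a bounded factor.\<close>
  define p where "p u = f' u * cos u + f u * sin u" for u
  define r where "r u = f u * cos u - f' u * sin u" for u
  have "(p has_real_derivative c / u\<^sup>2 * f u * cos u) (at u)" if "1 \<le> u" for u
    unfolding p_def using that
    by (auto intro!: derivative_eq_intros f f' simp: algebra_simps)
  from tendsto_at_top_of_derivative_bound[OF this bound] obtain A where A: "(p \<longlongrightarrow> A) at_top" by auto
  have "(r has_real_derivative c / u\<^sup>2 * f u * - sin u) (at u)" if "1 \<le> u" for u
    unfolding r_def using that
    by (auto intro!: derivative_eq_intros f f' simp: algebra_simps)
  from tendsto_at_top_of_derivative_bound[OF this bound] obtain B where B: "(r \<longlongrightarrow> B) at_top" by auto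
  have eq: "f u - (A * sin u + B * cos u) = (p u - A) * sin u + (r u - B) * cos u" for u
  proof -
    have "p u * sin u + r u * cos u = f u * ((sin u)\<^sup>2 + (cos u)\<^sup>2)"
      unfolding p_def r_def power2_eq_square by (simp only: algebra_simps)
    then show ?thesis by (simp add: left_diff_distrib)
  qed
  have "((\<lambda>u. (p u - A) * sin u) \<longlongrightarrow> 0) at_top" "((\<lambda>u. (r u - B) * cos u) \<longlongrightarrow> 0) at_top"
  proof (rule_tac [!] Lim_null_comparison)
    show "\<forall>\<^sub>F u in at_top. norm ((p u - A) * sin u) \<le> \<bar>p u - A\<bar>"
      by (intro always_eventually) (auto simp: abs_mult intro: mult_left_le)
    show "\<forall>\<^sub>F u in at_top. norm ((r u - B) * cos u) \<le> \<bar>r u - B\<bar>"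
      by (intro always_eventually) (auto simp: abs_mult intro: mult_left_le)
  qed (use A B in \<open>auto intro!: tendsto_rabs_zero LIM_zero\<close>)
  from tendsto_add[OF this] show "\<exists>A B. ((\<lambda>u. f u - (A * sin u + B * cos u)) \<longlongrightarrow> 0) at_top"
    by (intro exI[of _ A] exI[of _ B]) (simp add: eq)
qed

text \<open>Coefficients in the variable \<open>w = u^2\<close>, after the power of \<open>u\<close>
  has been split off. The series can then be differentiated everywhere, and only the power needs
  care at the origin.\<close>

definition bessel_coeff :: "real \<Rightarrow> nat \<Rightarrow> real" where
  "bessel_coeff \<alpha> k = (-1) ^ k * rGamma (\<alpha> + real k + 1) / (fact k * 4 ^ k)"

lemma bessel_coeff_Suc:
  assumes "\<alpha> > -1"
  shows "4 * (real k + 1) * (\<alpha> + real k + 1) * bessel_coeff \<alpha> (Suc k) = - bessel_coeff \<alpha> k"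
proof -
  have "rGamma (\<alpha> + real k + 1) = (\<alpha> + real k + 1) * rGamma (\<alpha> + real (Suc k) + 1)"
    using rGamma_plus1[of "\<alpha> + real k + 1"] by (simp add: add_ac)
  moreover have fact: "fact (Suc k) * 4 ^ Suc k = 4 * (real k + 1) * (fact k * 4 ^ k)"
    by (simp add: algebra_simps)
  have "bessel_coeff \<alpha> (Suc k) = - ((-1) ^ k) * rGamma (\<alpha> + real (Suc k) + 1)
      / (4 * (real k + 1) * (fact k * 4 ^ k))"
    unfolding bessel_coeff_def fact by simp
  moreover have "4 * a * b * (- s * r / (4 * a * d)) = - (s * (b * r) / d)"
    if "a \<noteq> 0" for a b d r s :: real
    using that by (simp add: field_simps)
  ultimately show ?thesis by (simp only:) (simp add: bessel_coeff_def)
qed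

lemma summable_bessel_coeff:
  assumes "\<alpha> > -1"
  shows "summable (\<lambda>k. bessel_coeff \<alpha> k * w ^ k)"
proof -
  \<comment> \<open>From this index on, consecutive terms have ratio at most 1/2, as the recurrence
    divides by \<open>4 * (k + 1) * (\<alpha> + k + 1)\<close>.\<close>
  obtain N :: nat where N: "\<bar>w\<bar> / (\<alpha> + 1) \<le> real N" using real_arch_simple by blast
  show ?thesis
  proof (rule summable_ratio_test[of "1/2" N])
    fix k assume k: "N \<le> k"
    have pos: "0 < 4 * (real k + 1) * (\<alpha> + real k + 1)" using assms by auto
    have "\<bar>w\<bar> \<le> real N * (\<alpha> + 1)" using N assms by (simp add: field_simps)
    also have "\<dots> \<le> (real k + 1) * (\<alpha> + real k + 1)"
      using k assms by (intro mult_mono) auto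
    finally have "2 * \<bar>w\<bar> \<le> 4 * ((real k + 1) * (\<alpha> + real k + 1))" by linarith
    then have w: "2 * \<bar>w\<bar> \<le> 4 * (real k + 1) * (\<alpha> + real k + 1)" by (simp only: mult.assoc)
    have "bessel_coeff \<alpha> (Suc k) = - bessel_coeff \<alpha> k / (4 * (real k + 1) * (\<alpha> + real k + 1))"
      using bessel_coeff_Suc[OF assms, of k] pos
      by (metis less_irrefl nonzero_mult_div_cancel_left)
    then have "norm (bessel_coeff \<alpha> (Suc k) * w ^ Suc k)
        = norm (bessel_coeff \<alpha> k * w ^ k) * (\<bar>w\<bar> / (4 * (real k + 1) * (\<alpha> + real k + 1)))"
      using assms by (simp add: abs_mult)
    also have "\<dots> \<le> norm (bessel_coeff \<alpha> k * w ^ k) * (1 / 2)"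
      using w pos by (intro mult_left_mono) (auto simp: divide_le_eq)
    finally show "norm (bessel_coeff \<alpha> (Suc k) * w ^ Suc k) \<le> 1 / 2 * norm (bessel_coeff \<alpha> k * w ^ k)"
      by simp
  qed simp
qed

lemma sqrt_bessel_J_eq:
  assumes "0 \<le> u"
  shows "sqrt u * bessel_J \<alpha> u
    = 2 powr (-\<alpha>) * u powr (\<alpha> + 1/2) * (\<Sum>k. bessel_coeff \<alpha> k * (u\<^sup>2) ^ k)"
proof -
  have "(\<lambda>k. (-1) ^ k * rGamma (\<alpha> + real k + 1) / fact k * (u / 2) ^ (2 * k))
      = (\<lambda>k. bessel_coeff \<alpha> k * (u\<^sup>2) ^ k)"
    by (auto simp: bessel_coeff_def power_mult power_divide)
  moreover have "sqrt u * (u / 2) powr \<alpha> = 2 powr (-\<alpha>) * u powr (\<alpha> + 1/2)"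
  proof -
    have "(u / 2) powr \<alpha> = u powr \<alpha> / 2 powr \<alpha>" by (rule powr_divide)
    moreover have "u powr (\<alpha> + 1/2) = u powr \<alpha> * sqrt u"
      using assms powr_half_sqrt[of u] by (metis powr_add)
    moreover have "2 powr (-\<alpha>) = 1 / 2 powr \<alpha>" by (rule powr_minus_divide)
    ultimately show ?thesis by (simp only:) simp
  qed
  ultimately show ?thesis by (simp add: bessel_J_def)
qed

text \<open>Bessel's equation after the substitution \<open>w = u^2\<close>, namely
  \<open>4 * (w * Y'' + (\<alpha> + 1) * Y') = - Y\<close>. Comparison of the coefficients of
  \<open>w ^ n\<close> is exactly \<open>bessel_coeff_Suc\<close>.\<close>

lemma bessel_coeff_series_ode:
  fixes \<alpha> w :: real
  assumes "\<alpha> > -1"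
  defines "c \<equiv> bessel_coeff \<alpha>"
  shows "4 * (w * (\<Sum>n. diffs (diffs c) n * w ^ n) + (\<alpha> + 1) * (\<Sum>n. diffs c n * w ^ n))
    = - (\<Sum>n. c n * w ^ n)"
proof -
  have s0: "summable (\<lambda>n. c n * x ^ n)" for x
    unfolding c_def by (rule summable_bessel_coeff[OF assms(1)])
  have s1: "summable (\<lambda>n. diffs c n * x ^ n)" for x
    using termdiff_converges_all[OF s0] .
  have s2: "summable (\<lambda>n. diffs (diffs c) n * x ^ n)" for x
    using termdiff_converges_all[OF s1] .
  \<comment> \<open>The factor \<open>w\<close> shifts the series of the second derivative by one
    index; the term gained at index 0 vanishes through the factor \<open>real n\<close>.\<close>
  define f where "f n = real n * diffs c n * w ^ n" for n
  have "(\<lambda>n. w * (diffs (diffs c) n * w ^ n)) sums (w * (\<Sum>n. diffs (diffs c) n * w ^ n))"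
    by (intro sums_mult summable_sums s2)
  also have "(\<lambda>n. w * (diffs (diffs c) n * w ^ n)) = (\<lambda>n. f (Suc n))"
    by (auto simp: f_def diffs_def[of "diffs c"])
  finally have "f sums (w * (\<Sum>n. diffs (diffs c) n * w ^ n))"
    by (subst (asm) sums_Suc_iff) (simp add: f_def)
  from sums_mult[OF sums_add[OF this sums_mult[OF summable_sums[OF s1[of w]], of "\<alpha> + 1"]], of 4]
  have "(\<lambda>n. 4 * (f n + (\<alpha> + 1) * (diffs c n * w ^ n))) sums
      (4 * (w * (\<Sum>n. diffs (diffs c) n * w ^ n) + (\<alpha> + 1) * (\<Sum>n. diffs c n * w ^ n)))" .
  moreover have "4 * (f n + (\<alpha> + 1) * (diffs c n * w ^ n)) = - (c n * w ^ n)" for n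
  proof -
    have "4 * (f n + (\<alpha> + 1) * (diffs c n * w ^ n))
        = 4 * (real n + 1) * (\<alpha> + real n + 1) * c (Suc n) * w ^ n"
      by (simp add: f_def diffs_def algebra_simps)
    then show ?thesis using bessel_coeff_Suc[OF assms(1), of n] by (simp add: c_def)
  qed
  ultimately show ?thesis
    using sums_unique2[OF _ sums_minus[OF summable_sums[OF s0[of w]]]] by simp
qed

text \<open>The factor \<open>sqrt u\<close> puts Bessel's equation into Liouville normal form,
  without a first-order term: the kernel is a harmonic oscillator with a perturbation of size
  \<open>1 / u^2\<close>, as \<open>oscillator_asymptotics\<close> requires.\<close>

lemma sqrt_bessel_J_ode:
  assumes "\<alpha> > -1"
  shows "\<exists>f'. \<forall>u>0. ((\<lambda>u. sqrt u * bessel_J \<alpha> u) has_real_derivative f' u) (at u) \<and>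
    (f' has_real_derivative ((\<alpha>\<^sup>2 - 1/4) / u\<^sup>2 - 1) * (sqrt u * bessel_J \<alpha> u)) (at u)"
proof -
  define \<beta> where "\<beta> = \<alpha> + 1/2"
  define K where "K = 2 powr (-\<alpha>)"
  define c where "c = bessel_coeff \<alpha>"
  have s0: "summable (\<lambda>n. c n * x ^ n)" for x
    unfolding c_def by (rule summable_bessel_coeff[OF assms(1)])
  have s1: "summable (\<lambda>n. diffs c n * x ^ n)" for x
    using termdiff_converges_all[OF s0] .
  define Y0 where "Y0 x = (\<Sum>n. c n * x ^ n)" for x
  define Y1 where "Y1 x = (\<Sum>n. diffs c n * x ^ n)" for x
  define Y2 where "Y2 x = (\<Sum>n. diffs (diffs c) n * x ^ n)" for x
  have Y0': "(Y0 has_real_derivative Y1 x) (at x)" for x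
    unfolding Y0_def Y1_def by (rule termdiffs_strong_converges_everywhere[OF s0])
  have Y1': "(Y1 has_real_derivative Y2 x) (at x)" for x
    unfolding Y1_def Y2_def by (rule termdiffs_strong_converges_everywhere[OF s1])
  note [derivative_intros] = DERIV_chain2[OF Y0'] DERIV_chain2[OF Y1']
  define f' where "f' u = K * (\<beta> * u powr (\<beta> - 1) * Y0 (u\<^sup>2) + u powr \<beta> * (2 * u * Y1 (u\<^sup>2)))" for u
  have f: "sqrt u * bessel_J \<alpha> u = K * u powr \<beta> * Y0 (u\<^sup>2)" if "0 \<le> u" for u
    using sqrt_bessel_J_eq[OF that] by (simp add: K_def \<beta>_def Y0_def c_def)
  show ?thesis
  proof (intro exI[of _ f'] allI impI conjI)
    fix u :: real assume u: "0 < u"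
    have "((\<lambda>u. K * u powr \<beta> * Y0 (u\<^sup>2)) has_real_derivative f' u) (at u)"
      unfolding f'_def using u by (auto intro!: derivative_eq_intros simp: field_simps)
    then show "((\<lambda>u. sqrt u * bessel_J \<alpha> u) has_real_derivative f' u) (at u)"
      by (rule has_field_derivative_transform_within_open[of _ _ _ "{0<..}"]) (use u f in auto)
    have ode: "4 * (u\<^sup>2 * Y2 (u\<^sup>2) + (\<alpha> + 1) * Y1 (u\<^sup>2)) = - Y0 (u\<^sup>2)"
      unfolding Y0_def Y1_def Y2_def c_def by (rule bessel_coeff_series_ode[OF assms])
    have p1: "u powr (\<beta> - 1) = u powr \<beta> / u" and p2: "u powr (\<beta> - 1 - 1) = u powr \<beta> / u\<^sup>2"
      using u by (simp_all add: powr_diff power2_eq_square)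
    have "(f' has_real_derivative
        K * (\<beta> * ((\<beta> - 1) * u powr (\<beta> - 1 - 1)) * Y0 (u\<^sup>2) + \<beta> * u powr (\<beta> - 1) * (2 * u * Y1 (u\<^sup>2))
          + (\<beta> * u powr (\<beta> - 1) * (2 * u * Y1 (u\<^sup>2)) + u powr \<beta> * (2 * Y1 (u\<^sup>2) + 2 * u * (2 * u * Y2 (u\<^sup>2))))))
      (at u)" (is "(f' has_real_derivative ?D) (at u)")
      unfolding f'_def using u by (auto intro!: derivative_eq_intros simp: algebra_simps)
    also have "?D = K * u powr \<beta> * (\<beta> * (\<beta> - 1) / u\<^sup>2 * Y0 (u\<^sup>2)
        + 4 * (u\<^sup>2 * Y2 (u\<^sup>2) + (\<beta> + 1/2) * Y1 (u\<^sup>2)))"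
      unfolding p1 p2 using u by (simp add: field_simps power2_eq_square)
    also have "\<beta> + 1/2 = \<alpha> + 1" by (simp add: \<beta>_def)
    also note ode
    also have "\<beta> * (\<beta> - 1) = \<alpha>\<^sup>2 - 1/4" by (simp add: \<beta>_def power2_eq_square algebra_simps)
    also have "K * u powr \<beta> * ((\<alpha>\<^sup>2 - 1/4) / u\<^sup>2 * Y0 (u\<^sup>2) + - Y0 (u\<^sup>2))
        = ((\<alpha>\<^sup>2 - 1/4) / u\<^sup>2 - 1) * (sqrt u * bessel_J \<alpha> u)"
      using u by (simp add: f algebra_simps)
    finally show "(f' has_real_derivative ((\<alpha>\<^sup>2 - 1/4) / u\<^sup>2 - 1) * (sqrt u * bessel_J \<alpha> u)) (at u)" .
  qed
qed

text \<open>Only the origin is delicate: \<open>\<alpha> > -1/2\<close> makes the exponent of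
  \<open>u powr (\<alpha> + 1/2)\<close> positive.\<close>

lemma continuous_on_sqrt_bessel_J:
  assumes "\<alpha> > -1/2"
  shows "continuous_on {0..} (\<lambda>u. sqrt u * bessel_J \<alpha> u)"
proof -
  have "\<alpha> > -1" using assms by simp
  from DERIV_isCont[OF termdiffs_strong_converges_everywhere[OF summable_bessel_coeff[OF this]]]
  have "continuous_on UNIV (\<lambda>x. \<Sum>n. bessel_coeff \<alpha> n * x ^ n)"
    by (intro continuous_at_imp_continuous_on ballI)
  then have "continuous_on {0..} (\<lambda>u. \<Sum>n. bessel_coeff \<alpha> n * (u\<^sup>2) ^ n)"
    by (rule continuous_on_compose2) (auto intro!: continuous_intros)
  then have "continuous_on {0..}
      (\<lambda>u. 2 powr (-\<alpha>) * u powr (\<alpha> + 1/2) * (\<Sum>k. bessel_coeff \<alpha> k * (u\<^sup>2) ^ k))"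
    using assms by (intro continuous_on_mult continuous_on_const continuous_on_powr' continuous_on_id) auto
  then show ?thesis
    by (rule continuous_on_eq) (simp add: sqrt_bessel_J_eq)
qed

lemma sqrt_bessel_J_asymptotics:
  assumes "\<alpha> > -1"
  shows "\<exists>A B. ((\<lambda>u. sqrt u * bessel_J \<alpha> u - (A * sin u + B * cos u)) \<longlongrightarrow> 0) at_top"
proof -
  obtain f' where "\<forall>u>0. ((\<lambda>u. sqrt u * bessel_J \<alpha> u) has_real_derivative f' u) (at u) \<and>
    (f' has_real_derivative ((\<alpha>\<^sup>2 - 1/4) / u\<^sup>2 - 1) * (sqrt u * bessel_J \<alpha> u)) (at u)"
    using sqrt_bessel_J_ode[OF assms] by blast
  then show ?thesis
    by (intro oscillator_asymptotics(2)[of _ f' "\<alpha>\<^sup>2 - 1/4"]) auto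
qed

lemma sqrt_bessel_J_bounded:
  assumes "\<alpha> > -1/2"
  shows "\<exists>m. \<forall>u\<ge>0. \<bar>sqrt u * bessel_J \<alpha> u\<bar> \<le> m"
proof -
  have "\<alpha> > -1" using assms by simp
  obtain f' where "\<forall>u>0. ((\<lambda>u. sqrt u * bessel_J \<alpha> u) has_real_derivative f' u) (at u) \<and>
    (f' has_real_derivative ((\<alpha>\<^sup>2 - 1/4) / u\<^sup>2 - 1) * (sqrt u * bessel_J \<alpha> u)) (at u)"
    using sqrt_bessel_J_ode[OF \<open>\<alpha> > -1\<close>] by blast
  then obtain m1 where m1: "\<forall>u\<ge>1. \<bar>sqrt u * bessel_J \<alpha> u\<bar> \<le> m1"
    using oscillator_asymptotics(1)[of "\<lambda>u. sqrt u * bessel_J \<alpha> u" f' "\<alpha>\<^sup>2 - 1/4"] by auto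
  have "bounded ((\<lambda>u. sqrt u * bessel_J \<alpha> u) ` {0..1})"
    by (intro compact_imp_bounded compact_continuous_image
        continuous_on_subset[OF continuous_on_sqrt_bessel_J[OF assms]]) auto
  then obtain m0 where m0: "\<forall>u\<in>{0..1}. \<bar>sqrt u * bessel_J \<alpha> u\<bar> \<le> m0"
    unfolding bounded_iff by auto
  have "\<bar>sqrt u * bessel_J \<alpha> u\<bar> \<le> max m0 m1" if "0 \<le> u" for u
  proof (cases "u \<le> 1")
    case True then show ?thesis using m0 that by (intro max.coboundedI1) auto
  next
    case False then show ?thesis using m1 by (intro max.coboundedI2) auto
  qed
  then show ?thesis by blast
qed

section \<open>Trigonometric functions on an interval\<close>

text \<open>Free phases take the place of separate sines and leave a single case in product
  formulas. A set of frequencies instead of a degree allows bands centred far from the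
  origin.\<close>

inductive trig_span :: "real \<Rightarrow> int set \<Rightarrow> (real \<Rightarrow> real) \<Rightarrow> bool" for \<omega> J where
  trig_span_zero: "trig_span \<omega> J (\<lambda>x. 0)"
| trig_span_cos: "j \<in> J \<Longrightarrow> trig_span \<omega> J (\<lambda>x. c * cos (of_int j * \<omega> * x + \<theta>))"
| trig_span_add: "trig_span \<omega> J f \<Longrightarrow> trig_span \<omega> J g \<Longrightarrow> trig_span \<omega> J (\<lambda>x. f x + g x)"

lemma trig_span_mono:
  assumes "trig_span \<omega> J f" "J \<subseteq> J'"
  shows "trig_span \<omega> J' f"
  using assms by (induction rule: trig_span.induct) (auto intro: trig_span.intros)

lemma trig_span_cmult:
  assumes "trig_span \<omega> J f"
  shows "trig_span \<omega> J (\<lambda>x. d * f x)"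
  using assms
proof (induction rule: trig_span.induct)
  case (trig_span_cos j c \<theta>)
  then show ?case
    using trig_span.trig_span_cos[of j J \<omega> "d * c" \<theta>] by (simp add: mult.assoc)
qed (auto intro: trig_span.intros simp: distrib_left)

text \<open>Product-to-sum formulas send a frequency \<open>j\<close> to \<open>m + j\<close> and
  \<open>m - j\<close>, so the band keeps its width however large \<open>m\<close> is.\<close>

lemma trig_span_mult_cos:
  assumes "trig_span \<omega> {-R..R} f"
  shows "trig_span \<omega> {m - R..m + R} (\<lambda>x. f x * cos (of_int m * \<omega> * x + \<eta>))"
  using assms
proof (induction rule: trig_span.induct)
  case (trig_span_cos j c \<theta>)
  have "c * cos (of_int j * \<omega> * x + \<theta>) * cos (of_int m * \<omega> * x + \<eta>)
      = c / 2 * cos (of_int (m + j) * \<omega> * x + (\<eta> + \<theta>)) + c / 2 * cos (of_int (m - j) * \<omega> * x + (\<eta> - \<theta>))"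
    for x
  proof -
    let ?X = "of_int m * \<omega> * x + \<eta>" and ?Y = "of_int j * \<omega> * x + \<theta>"
    have "of_int (m + j) * \<omega> * x + (\<eta> + \<theta>) = ?X + ?Y" "of_int (m - j) * \<omega> * x + (\<eta> - \<theta>) = ?X - ?Y"
      by (simp_all add: algebra_simps)
    moreover have "c * cos Y * cos X = c / 2 * cos (X + Y) + c / 2 * cos (X - Y)" for X Y :: real
      by (simp add: cos_add cos_diff field_simps)
    ultimately show ?thesis by (simp only:)
  qed
  moreover have "m + j \<in> {m - R..m + R}" "m - j \<in> {m - R..m + R}"
    using trig_span_cos by auto
  ultimately show ?case
    by (simp only:) (intro trig_span.intros)
qed (auto intro: trig_span.intros simp: distrib_right)

lemma trig_span_mult:
  assumes "trig_span \<omega> {-R..R} f" "trig_span \<omega> {-T..T} g"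
  shows "trig_span \<omega> {-(R + T)..R + T} (\<lambda>x. f x * g x)"
  using assms(2)
proof (induction rule: trig_span.induct)
  case (trig_span_cos j c \<theta>)
  have "trig_span \<omega> {-(R + T)..R + T} (\<lambda>x. c * (f x * cos (of_int j * \<omega> * x + \<theta>)))"
    by (intro trig_span_cmult trig_span_mono[OF trig_span_mult_cos[OF assms(1)]])
       (use trig_span_cos in auto)
  then show ?case by (simp add: mult_ac)
qed (auto intro: trig_span.intros simp: distrib_left)

text \<open>Along the circle a real linear functional becomes a combination of a cosine and a sine.
  This turns polynomial approximation on the circle, as given by Stone-Weierstrass, into
  trigonometric approximation.\<close>

lemma trig_span_real_polynomial:
  fixes p :: "complex \<Rightarrow> real"
  assumes "real_polynomial_function p"
  shows "\<exists>R\<ge>0. trig_span \<omega> {-R..R} (\<lambda>x. p (cis (\<omega> * x)))"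
  using assms
proof (induction rule: real_polynomial_function.induct)
  case (linear f)
  interpret bounded_linear f by fact
  have "f (cis (\<omega> * x)) = f 1 * cos (of_int 1 * \<omega> * x + 0) + f \<i> * cos (of_int 1 * \<omega> * x + - pi / 2)" for x
  proof -
    have "cis (\<omega> * x) = cos (\<omega> * x) *\<^sub>R 1 + sin (\<omega> * x) *\<^sub>R \<i>" by (simp add: complex_eq_iff)
    moreover have "cos (\<omega> * x - pi / 2) = sin (\<omega> * x)" by (simp add: cos_diff)
    ultimately show ?thesis by (simp only: add scaleR) simp
  qed
  moreover have "trig_span \<omega> {-1..1}
      (\<lambda>x. f 1 * cos (of_int 1 * \<omega> * x + 0) + f \<i> * cos (of_int 1 * \<omega> * x + - pi / 2))"
    by (intro trig_span.intros) auto
  ultimately show ?case by (intro exI[of _ 1]) simp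
next
  case (const c)
  have "trig_span \<omega> {-0..0} (\<lambda>x. c * cos (of_int 0 * \<omega> * x + 0))"
    by (intro trig_span.intros) auto
  then show ?case by (intro exI[of _ 0]) simp
next
  case (add f g)
  then obtain R T where RT: "R \<ge> 0" "T \<ge> 0" and "trig_span \<omega> {-R..R} (\<lambda>x. f (cis (\<omega> * x)))"
    "trig_span \<omega> {-T..T} (\<lambda>x. g (cis (\<omega> * x)))" by blast
  then show ?case
    by (intro exI[of _ "max R T"])
       (auto intro!: trig_span_add elim!: trig_span_mono)
next
  case (mult f g)
  then obtain R T where RT: "R \<ge> 0" "T \<ge> 0" and "trig_span \<omega> {-R..R} (\<lambda>x. f (cis (\<omega> * x)))"
    "trig_span \<omega> {-T..T} (\<lambda>x. g (cis (\<omega> * x)))" by blast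
  then show ?case
    by (intro exI[of _ "R + T"] conjI trig_span_mult) auto
qed

lemma trig_span_continuous:
  assumes "trig_span \<omega> J f"
  shows "continuous_on UNIV f"
  using assms by (induction rule: trig_span.induct) (auto intro!: continuous_intros)

text \<open>The boolean selects cosine (\<open>False\<close>) or sine (\<open>True\<close>), the
  latter as a cosine with phase shift. The factor \<open>sqrt (2 / L)\<close> normalises nonzero
  frequencies only.\<close>

definition trig_basis :: "real \<Rightarrow> int \<times> bool \<Rightarrow> real \<Rightarrow> real" where
  "trig_basis L i x = indicator {0..L} x *
     (sqrt (2 / L) * cos (of_int (fst i) * (2 * pi / L) * x - of_bool (snd i) * (pi / 2)))"

lemma trig_span_expansion:
  assumes "trig_span (2 * pi / L) J f" "finite J" "L > 0"
  shows "\<exists>c. \<forall>x. indicator {0..L} x * f x = (\<Sum>i\<in>J \<times> UNIV. c i * trig_basis L i x)"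
  using assms
proof (induction rule: trig_span.induct)
  case trig_span_zero
  then show ?case by (intro exI[of _ "\<lambda>_. 0"]) simp
next
  case (trig_span_cos j c \<theta>)
  define s where "s = sqrt (2 / L)"
  have s: "s > 0" using trig_span_cos by (simp add: s_def)
  define d where "d i = (if i = (j, False) then c * cos \<theta> / s else if i = (j, True) then - c * sin \<theta> / s else 0)"
    for i :: "int \<times> bool"
  have "indicator {0..L} x * (c * cos (of_int j * (2 * pi / L) * x + \<theta>))
      = (\<Sum>i\<in>J \<times> UNIV. d i * trig_basis L i x)" for x
  proof -
    have "(\<Sum>i\<in>J \<times> UNIV. d i * trig_basis L i x) = (\<Sum>i\<in>{(j, False), (j, True)}. d i * trig_basis L i x)"
      using trig_span_cos by (intro sum.mono_neutral_right) (auto simp: d_def)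
    also have "\<dots> = indicator {0..L} x * (c * cos (of_int j * (2 * pi / L) * x + \<theta>))"
      using s by (simp add: d_def trig_basis_def s_def[symmetric] cos_add cos_diff algebra_simps)
    finally show ?thesis by simp
  qed
  then show ?case by blast
next
  case (trig_span_add f g)
  then obtain c d where "\<forall>x. indicator {0..L} x * f x = (\<Sum>i\<in>J \<times> UNIV. c i * trig_basis L i x)"
    "\<forall>x. indicator {0..L} x * g x = (\<Sum>i\<in>J \<times> UNIV. d i * trig_basis L i x)" by blast
  then show ?case
    by (intro exI[of _ "\<lambda>i. c i + d i"]) (simp add: distrib_left distrib_right sum.distrib)
qed

lemma integrable_indicator_Icc_mult:
  fixes f :: "real \<Rightarrow> real"
  assumes "continuous_on {a..b} f"
  shows "integrable lebesgue (\<lambda>x. indicator {a..b} x * f x)"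
  using continuous_imp_integrable_real[OF assms] by (simp add: integrable_restrict_space)

lemma integral_cos_full_periods:
  fixes n :: int
  assumes "L > 0"
  shows "(LINT x|lebesgue. indicator {0..L} x * cos (of_int n * (2 * pi / L) * x + \<theta>))
    = (if n = 0 then L * cos \<theta> else 0)"
proof -
  define \<omega> where "\<omega> = of_int n * (2 * pi / L)"
  have int: "integrable (lebesgue_on {0..L}) (\<lambda>x. cos (\<omega> * x + \<theta>))"
    by (intro continuous_imp_integrable_real continuous_intros)
  have "(LINT x|lebesgue. indicator {0..L} x * cos (\<omega> * x + \<theta>))
      = integral\<^sup>L (lebesgue_on {0..L}) (\<lambda>x. cos (\<omega> * x + \<theta>))"
    by (simp add: integral_restrict_space)
  also have "\<dots> = integral {0..L} (\<lambda>x. cos (\<omega> * x + \<theta>))"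
    by (intro lebesgue_integral_eq_integral int) auto
  also have "\<dots> = (if n = 0 then L * cos \<theta> else 0)"
  proof (cases "n = 0")
    case True
    then show ?thesis using assms by (simp add: \<omega>_def)
  next
    case False
    then have \<omega>: "\<omega> \<noteq> 0" using assms by (simp add: \<omega>_def)
    have "((\<lambda>x. cos (\<omega> * x + \<theta>)) has_integral
        (sin (\<omega> * L + \<theta>) / \<omega> - sin (\<omega> * 0 + \<theta>) / \<omega>)) {0..L}"
      using assms \<omega>
      by (intro fundamental_theorem_of_calculus)
         (auto intro!: derivative_eq_intros simp: has_real_derivative_iff_has_vector_derivative[symmetric])
    moreover have "\<omega> * L = 2 * pi * of_int n" using assms by (simp add: \<omega>_def)
    then have "sin (\<omega> * L + \<theta>) = sin \<theta>"
      by (simp add: sin_add sin_int_2pin cos_int_2pin)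
    ultimately show ?thesis using False by (simp add: integral_unique)
  qed
  finally show ?thesis by (simp add: \<omega>_def)
qed

lemma square_integrable_indicator_mult:
  fixes f :: "real \<Rightarrow> real"
  assumes "S \<in> lmeasurable" and "f \<in> borel_measurable (lebesgue_on S)" and "\<And>x. x \<in> S \<Longrightarrow> \<bar>f x\<bar> \<le> m"
  shows "square_integrable lebesgue (\<lambda>x. indicator S x * f x)"
proof -
  have S: "S \<in> sets lebesgue" using assms(1) by (simp add: fmeasurableD)
  have meas: "(\<lambda>x. indicator S x * f x) \<in> borel_measurable lebesgue"
    using assms(2) borel_measurable_restrict_space_iff[of S lebesgue f] S by simp
  have "integrable lebesgue (\<lambda>x. (indicator S x * f x)\<^sup>2)"
  proof (rule Bochner_Integration.integrable_bound)
    show "integrable lebesgue (\<lambda>x. m\<^sup>2 * indicator S x)"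
      using assms(1) by (simp add: lmeasurable_iff_integrable)
    show "(\<lambda>x. (indicator S x * f x)\<^sup>2) \<in> borel_measurable lebesgue"
      using meas by measurable
    have "(f x)\<^sup>2 \<le> m\<^sup>2" if "x \<in> S" for x
      using assms(3)[OF that] by (meson abs_ge_zero abs_le_square_iff order_trans power2_le_iff_abs_le)
    then show "AE x in lebesgue. norm ((indicator S x * f x)\<^sup>2) \<le> norm (m\<^sup>2 * indicator S x)"
      by (auto intro!: AE_I2 simp: indicator_def)
  qed
  with meas show ?thesis by (simp add: square_integrable_def)
qed

lemma square_integrable_trig_basis:
  assumes "L > 0"
  shows "square_integrable lebesgue (trig_basis L i)"
  unfolding trig_basis_def[abs_def]
proof (rule square_integrable_indicator_mult[where m = "\<bar>sqrt (2 / L)\<bar>"])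
  show "\<bar>sqrt (2 / L) * cos (of_int (fst i) * (2 * pi / L) * x - of_bool (snd i) * (pi / 2))\<bar> \<le> \<bar>sqrt (2 / L)\<bar>" for x
    unfolding abs_mult by (intro mult_left_le) auto
qed (use assms in \<open>auto intro!: continuous_imp_measurable_on_sets_lebesgue continuous_intros\<close>)

text \<open>For positive frequencies the sum frequency in the product formula never vanishes, so
  only the difference frequency can contribute. For equal frequencies it leaves
  \<open>cos (\<delta> - \<beta>)\<close>, which is 1 for equal booleans and 0 otherwise.\<close>

lemma trig_basis_orthonormal:
  assumes "L > 0" "fst i > 0" "fst k > 0"
  shows "L2_inner lebesgue (trig_basis L i) (trig_basis L k) = of_bool (i = k)"
proof -
  obtain j b where i: "i = (j, b)" by (cases i)
  obtain l d where k: "k = (l, d)" by (cases k)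
  define \<beta> \<delta> where "\<beta> = of_bool b * (pi / 2)" and "\<delta> = of_bool d * (pi / 2)"
  define h where "h n \<theta> x = indicator {0..L} x * cos (of_int n * (2 * pi / L) * x + \<theta>)" for n \<theta> x
  have h_integrable: "integrable lebesgue (h n \<theta>)" for n \<theta>
    unfolding h_def by (intro integrable_indicator_Icc_mult continuous_intros) (use assms in auto)
  have h_integral: "integral\<^sup>L lebesgue (h n \<theta>) = (if n = 0 then L * cos \<theta> else 0)" for n \<theta>
    unfolding h_def by (rule integral_cos_full_periods[OF assms(1)])
  define s where "s = sqrt (2 / L)"
  have ss: "s * s = 2 / L" using assms by (simp add: s_def)
  have "trig_basis L i x * trig_basis L k x
      = 1 / L * h (j - l) (\<delta> - \<beta>) x + 1 / L * h (j + l) (- \<delta> - \<beta>) x" for x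
  proof -
    have "trig_basis L i x = indicator {0..L} x * (s * cos (of_int j * (2 * pi / L) * x - \<beta>))"
      "trig_basis L k x = indicator {0..L} x * (s * cos (of_int l * (2 * pi / L) * x - \<delta>))"
      by (simp_all add: trig_basis_def i k \<beta>_def \<delta>_def s_def)
    then have "trig_basis L i x * trig_basis L k x = indicator {0..L} x * (s * s) *
        (cos (of_int j * (2 * pi / L) * x - \<beta>) * cos (of_int l * (2 * pi / L) * x - \<delta>))"
      by (simp only:) (simp add: indicator_def)
    also note ss
    also have "cos (of_int j * (2 * pi / L) * x - \<beta>) * cos (of_int l * (2 * pi / L) * x - \<delta>)
        = (cos (of_int (j - l) * (2 * pi / L) * x + (\<delta> - \<beta>)) + cos (of_int (j + l) * (2 * pi / L) * x + (- \<delta> - \<beta>))) / 2"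
    proof -
      let ?X = "of_int j * (2 * pi / L) * x - \<beta>" and ?Y = "of_int l * (2 * pi / L) * x - \<delta>"
      have "of_int (j - l) * (2 * pi / L) * x + (\<delta> - \<beta>) = ?X - ?Y"
        "of_int (j + l) * (2 * pi / L) * x + (- \<delta> - \<beta>) = ?X + ?Y"
        by (simp_all add: algebra_simps add_divide_distrib diff_divide_distrib)
      then show ?thesis by (simp only: cos_times_cos)
    qed
    also have "y * (2 / L) * ((a + b) / 2) = 1 / L * (y * a) + 1 / L * (y * b)" for a b y
      using assms by (simp add: field_simps)
    finally show ?thesis unfolding h_def .
  qed
  then have "L2_inner lebesgue (trig_basis L i) (trig_basis L k)
      = 1 / L * (if j - l = 0 then L * cos (\<delta> - \<beta>) else 0)
      + 1 / L * (if j + l = 0 then L * cos (- \<delta> - \<beta>) else 0)"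
    unfolding L2_inner_def by (simp add: h_integrable h_integral)
  then show ?thesis
    using assms by (auto simp: i k \<beta>_def \<delta>_def)
qed

text \<open>The cosine and the sine of one frequency have squares adding up to a constant, so each
  frequency contributes the same energy on \<open>S\<close>, whatever the shape of
  \<open>S\<close>.\<close>

lemma trig_basis_restrict_sum:
  assumes "S \<in> lmeasurable" "S \<subseteq> {0..L}" "L > 0" "finite J"
  shows "(\<Sum>i\<in>J \<times> UNIV. L2_inner lebesgue (\<lambda>x. indicator S x * trig_basis L i x)
            (\<lambda>x. indicator S x * trig_basis L i x))
    = real (card J) * (2 * measure lebesgue S / L)"
proof -
  define \<phi> where "\<phi> i x = indicator S x * trig_basis L i x" for i x
  have sq: "square_integrable lebesgue (\<phi> i)" for i
  proof -
    have "\<phi> i = (\<lambda>x. indicator S x * (sqrt (2 / L) * cos (of_int (fst i) * (2 * pi / L) * x - of_bool (snd i) * (pi / 2))))"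
      using assms(2) by (auto simp: \<phi>_def trig_basis_def indicator_def fun_eq_iff)
    moreover have "square_integrable lebesgue \<dots>"
    proof (rule square_integrable_indicator_mult[where m = "\<bar>sqrt (2 / L)\<bar>"])
      show "\<bar>sqrt (2 / L) * cos (of_int (fst i) * (2 * pi / L) * x - of_bool (snd i) * (pi / 2))\<bar> \<le> \<bar>sqrt (2 / L)\<bar>" for x
        unfolding abs_mult by (intro mult_left_le) auto
    qed (use assms in \<open>auto intro!: continuous_imp_measurable_on_sets_lebesgue continuous_intros\<close>)
    ultimately show ?thesis by simp
  qed
  have "L2_inner lebesgue (\<phi> (j, False)) (\<phi> (j, False)) + L2_inner lebesgue (\<phi> (j, True)) (\<phi> (j, True))
      = 2 * measure lebesgue S / L" for j
  proof -
    have "L2_inner lebesgue (\<phi> (j, False)) (\<phi> (j, False)) + L2_inner lebesgue (\<phi> (j, True)) (\<phi> (j, True))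
        = (LINT x|lebesgue. \<phi> (j, False) x * \<phi> (j, False) x + \<phi> (j, True) x * \<phi> (j, True) x)"
      unfolding L2_inner_def by (intro Bochner_Integration.integral_add[symmetric] square_integrable_mult sq)
    also have "(\<lambda>x. \<phi> (j, False) x * \<phi> (j, False) x + \<phi> (j, True) x * \<phi> (j, True) x) = (\<lambda>x. 2 / L * indicator S x)"
    proof
      fix x
      let ?y = "of_int j * (2 * pi / L) * x"
      define s where "s = sqrt (2 / L)"
      have ss: "s * s = 2 / L" using assms by (simp add: s_def)
      have "cos (?y - pi / 2) = sin ?y" by (simp add: cos_diff)
      then have "\<phi> (j, False) x = indicator S x * (s * cos ?y)" "\<phi> (j, True) x = indicator S x * (s * sin ?y)"
        using assms(2) by (auto simp: \<phi>_def trig_basis_def indicator_def s_def)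
      moreover have "y * (s * a) * (y * (s * a)) + y * (s * b) * (y * (s * b)) = y * y * (s * s) * (a\<^sup>2 + b\<^sup>2)"
        for a b y :: real
        by (simp add: power2_eq_square algebra_simps)
      ultimately have "\<phi> (j, False) x * \<phi> (j, False) x + \<phi> (j, True) x * \<phi> (j, True) x
          = indicator S x * indicator S x * (s * s) * ((cos ?y)\<^sup>2 + (sin ?y)\<^sup>2)"
        by (simp only:)
      then show "\<phi> (j, False) x * \<phi> (j, False) x + \<phi> (j, True) x * \<phi> (j, True) x = 2 / L * indicator S x"
        by (simp only: ss sin_cos_squared_add2) (simp add: indicator_def)
    qed
    also have "(LINT x|lebesgue. 2 / L * indicator S x) = 2 * measure lebesgue S / L"
      using assms(1) by (simp add: fmeasurableD)
    finally show ?thesis .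
  qed
  then show ?thesis
    unfolding \<phi>_def[symmetric]
    by (simp add: sum.cartesian_product' UNIV_bool add.commute)
qed

section \<open>Trigonometric approximation\<close>

text \<open>Measurability gives continuous functions converging to the indicator almost everywhere.
  They are carried to the unit circle, where Stone-Weierstrass applies. As \<open>S\<close> fills at
  most half a period, it corresponds to the upper half circle, on which \<open>arccos (Re z)\<close>
  recovers the angle; the cutoff \<open>clamp (real n * Im z)\<close> suppresses the mirror image
  below the axis.\<close>

lemma indicator_trig_approx:
  assumes S: "S \<in> sets lebesgue" "S \<subseteq> {0..L/2}" and L: "L > 0" and \<epsilon>: "\<epsilon> > 0"
  shows "\<exists>R\<ge>0. \<exists>q. trig_span (2 * pi / L) {-R..R} q \<and>
    square_integrable lebesgue (\<lambda>x. indicator S x - indicator {0..L} x * q x) \<and>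
    L2_inner lebesgue (\<lambda>x. indicator S x - indicator {0..L} x * q x)
      (\<lambda>x. indicator S x - indicator {0..L} x * q x) \<le> \<epsilon>\<^sup>2"
proof -
  define \<omega> where "\<omega> = 2 * pi / L"
  have \<omega>: "\<omega> > 0" "\<omega> * L = 2 * pi" using L by (simp_all add: \<omega>_def)
  have "(\<lambda>x. 1 :: real) measurable_on S" using S(1) by simp
  then obtain N g where N: "negligible N" and g: "\<And>n. continuous_on UNIV (g n)"
    and g_lim: "\<And>x. x \<notin> N \<Longrightarrow> (\<lambda>n. g n x) \<longlonglongrightarrow> (if x \<in> S then 1 else 0 :: real)"
    unfolding measurable_on_def by metis
  \<comment> \<open>Truncation keeps the limits 0 and 1 and supplies the bound for dominated
    convergence.\<close>
  define clamp where "clamp y = max 0 (min 1 y)" for y :: real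
  have clamp: "0 \<le> clamp y" "clamp y \<le> 1" for y by (auto simp: clamp_def)
  have clamp_cont: "continuous_on A (\<lambda>z. clamp (h z))" if "continuous_on A h"
    for A and h :: "'a::topological_space \<Rightarrow> real"
    unfolding clamp_def by (intro continuous_intros that)
  \<comment> \<open>Functions on the circle that vanish on its lower half, which corresponds to \<open>{L/2..L}\<close>.\<close>
  define G where "G n z = clamp (g n (arccos (Re z) / \<omega>)) * clamp (real n * Im z)" for n z
  have Re_circle: "-1 \<le> Re z" "Re z \<le> 1" if "z \<in> sphere 0 1" for z
    using that abs_Re_le_cmod[of z] by auto
  have G_cont: "continuous_on (sphere 0 1) (G n)" for n
    unfolding G_def
    by (intro continuous_on_mult clamp_cont continuous_on_compose2[OF g] continuous_on_divide
        continuous_on_arccos continuous_intros) (use Re_circle \<omega> in auto)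
  define f where "f n x = G n (cis (\<omega> * x))" for n x
  have f_cont: "continuous_on UNIV (f n)" for n
    unfolding f_def by (intro continuous_on_compose2[OF G_cont] continuous_intros) auto
  have f01: "0 \<le> f n x" "f n x \<le> 1" for n x
    unfolding f_def G_def using clamp by (auto intro: mult_le_one)
  define I where "I = indicat_real {0..L}"
  have I_int: "integrable lebesgue I"
    using lmeasurable_iff_integrable[of "{0..L}"] by (simp add: I_def)
  define u where "u n x = I x * (indicator S x - f n x)\<^sup>2" for n x
  have f_lim: "(\<lambda>n. f n x) \<longlonglongrightarrow> indicator S x"
    if x: "0 < x" "x < L" "x \<noteq> L / 2" and "x \<notin> N" for x
  proof (cases "x < L / 2")
    case True
    then have \<omega>x: "0 < \<omega> * x" "\<omega> * x < pi" using \<omega> x L by (auto simp: \<omega>_def field_simps)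
    then have "arccos (Re (cis (\<omega> * x))) / \<omega> = x" using \<omega> by (simp add: arccos_cos)
    then have f: "f n x = clamp (g n x) * clamp (real n * sin (\<omega> * x))" for n
      by (simp add: f_def G_def)
    have sin: "0 < sin (\<omega> * x)" using \<omega>x by (intro sin_gt_zero) auto
    have "\<forall>\<^sub>F n in sequentially. clamp (real n * sin (\<omega> * x)) = 1"
    proof -
      obtain n0 :: nat where "1 / sin (\<omega> * x) < real n0" using reals_Archimedean2 by blast
      then have "1 \<le> real n * sin (\<omega> * x)" if "n \<ge> n0" for n
        using that sin by (simp add: pos_divide_less_eq)
          (smt (verit) mult_right_mono of_nat_mono)
      then show ?thesis by (auto simp: clamp_def eventually_sequentially intro!: exI[of _ n0])
    qed
    then have "(\<lambda>n. clamp (real n * sin (\<omega> * x))) \<longlonglongrightarrow> 1" by (rule tendsto_eventually)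
    moreover have "(\<lambda>n. clamp (g n x)) \<longlonglongrightarrow> clamp (if x \<in> S then 1 else 0)"
      unfolding clamp_def using g_lim[OF \<open>x \<notin> N\<close>] by (intro tendsto_intros)
    ultimately have "(\<lambda>n. f n x) \<longlonglongrightarrow> clamp (if x \<in> S then 1 else 0) * 1"
      unfolding f by (intro tendsto_mult)
    then show ?thesis by (simp add: clamp_def indicator_def split: if_splits)
  next
    case False
    then have "x \<notin> S" using S(2) x by auto
    have "pi \<le> \<omega> * x" "\<omega> * x \<le> 2 * pi"
      using False x L by (auto simp: \<omega>_def field_simps)
    then have "sin (\<omega> * x) \<le> 0" using sin_le_zero[of "\<omega> * x"] by (cases "\<omega> * x = 2 * pi") auto
    then have "clamp (real n * sin (\<omega> * x)) = 0" for n
      using mult_nonneg_nonpos[of "real n" "sin (\<omega> * x)"] by (simp add: clamp_def)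
    then have "f n x = 0" for n by (simp add: f_def G_def)
    then show ?thesis using \<open>x \<notin> S\<close> by simp
  qed
  have "(\<lambda>n. integral\<^sup>L lebesgue (u n)) \<longlonglongrightarrow> integral\<^sup>L lebesgue (\<lambda>x::real. 0)"
  proof (rule integral_dominated_convergence[where w = I])
    show "integrable lebesgue I" by (rule I_int)
    have f_meas: "f n \<in> borel_measurable lebesgue" for n
      using continuous_imp_measurable_on_sets_lebesgue[OF f_cont, of n] by (simp add: lebesgue_on_UNIV_eq)
    show "u n \<in> borel_measurable lebesgue" for n
      unfolding u_def[abs_def] I_def
      by (intro borel_measurable_times borel_measurable_power borel_measurable_diff
          borel_measurable_indicator f_meas S(1)) simp
    have "(indicator S x - f n x)\<^sup>2 \<le> 1" for n x
      using f01[of n x] unfolding abs_square_le_1 by (auto simp: indicator_def)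
    then show "AE x in lebesgue. norm (u n x) \<le> I x" for n
      by (auto simp: u_def I_def indicator_def)
    have "negligible (N \<union> {0, L/2, L})" using N by simp
    then have "AE x in lebesgue. x \<notin> N \<union> {0, L/2, L}"
      by (intro AE_not_in) (simp add: negligible_iff_null_sets)
    then show "AE x in lebesgue. (\<lambda>n. u n x) \<longlonglongrightarrow> 0"
    proof eventually_elim
      case (elim x)
      show ?case
      proof (cases "0 < x \<and> x < L")
        case True
        then have "(\<lambda>n. I x * (indicator S x - f n x)\<^sup>2) \<longlonglongrightarrow> I x * (indicator S x - indicator S x)\<^sup>2"
          using elim by (intro tendsto_intros f_lim) auto
        then show ?thesis by (simp add: u_def)
      next
        case False
        then have "I x = 0" using elim by (auto simp: I_def)
        then show ?thesis by (simp add: u_def)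
      qed
    qed
  qed simp
  then have "\<forall>\<^sub>F n in sequentially. integral\<^sup>L lebesgue (u n) < \<epsilon>\<^sup>2 / 4"
    using \<epsilon> by (intro order_tendstoD) auto
  then obtain n where n: "integral\<^sup>L lebesgue (u n) < \<epsilon>\<^sup>2 / 4"
    by (auto simp: eventually_sequentially)
  \<comment> \<open>Half of the squared error is left to the continuous functions and half to the
    polynomial; the quarters anticipate the factor 2 in
    \<open>(a + b)^2 \<le> 2 * a^2 + 2 * b^2\<close>.\<close>
  define \<delta> where "\<delta> = \<epsilon> / (2 * sqrt L)"
  have \<delta>: "\<delta> > 0" "\<delta>\<^sup>2 * L = \<epsilon>\<^sup>2 / 4"
    using \<epsilon> L by (simp_all add: \<delta>_def power_divide power_mult_distrib)
  obtain p where p: "real_polynomial_function p" and p_close: "\<And>z. z \<in> sphere 0 1 \<Longrightarrow> \<bar>G n z - p z\<bar> < \<delta>"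
    using Stone_Weierstrass_real_polynomial_function[OF compact_sphere G_cont \<delta>(1)] by blast
  define q where "q x = p (cis (\<omega> * x))" for x
  obtain R where R: "R \<ge> 0" "trig_span \<omega> {-R..R} q"
    using trig_span_real_polynomial[OF p] unfolding q_def by blast
  have fq: "\<bar>f n x - q x\<bar> < \<delta>" for x
    unfolding f_def q_def by (intro p_close) simp
  define d where "d x = indicator S x - I x * q x" for x
  have d: "d x = I x * (indicator S x - q x)" for x
    using S(2) L by (auto simp: d_def I_def indicator_def)
  have u_int: "integrable lebesgue (u n)"
  proof (rule Bochner_Integration.integrable_bound)
    show "integrable lebesgue I" by (rule I_int)
    have "f n \<in> borel_measurable lebesgue"
      using continuous_imp_measurable_on_sets_lebesgue[OF f_cont, of n] by (simp add: lebesgue_on_UNIV_eq)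
    then show "u n \<in> borel_measurable lebesgue"
      unfolding u_def[abs_def] I_def
      by (intro borel_measurable_times borel_measurable_power borel_measurable_diff
          borel_measurable_indicator S(1)) simp
    have "(indicator S x - f n x)\<^sup>2 \<le> 1" for x
      using f01[of n x] unfolding abs_square_le_1 by (auto simp: indicator_def)
    then show "AE x in lebesgue. norm (u n x) \<le> norm (I x)"
      by (auto simp: u_def I_def indicator_def)
  qed
  have "square_integrable lebesgue (\<lambda>x. indicator {0..L} x * (indicator S x - q x))"
  proof (rule square_integrable_indicator_mult)
    show "{0..L} \<in> lmeasurable" by simp
    have "q \<in> borel_measurable (lebesgue_on {0..L})"
      using trig_span_continuous[OF R(2)]
      by (intro continuous_imp_measurable_on_sets_lebesgue) (auto intro: continuous_on_subset)
    moreover have "indicat_real S \<in> borel_measurable (lebesgue_on {0..L})"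
      using S(1) by (intro measurable_restrict_space1) simp
    ultimately show "(\<lambda>x. indicator S x - q x) \<in> borel_measurable (lebesgue_on {0..L})"
      by measurable
    show "\<bar>indicator S x - q x\<bar> \<le> 1 + \<delta>" for x
      using f01[of n x] fq[of x] by (auto simp: indicator_def)
  qed
  then have sq: "square_integrable lebesgue d" by (simp add: d[abs_def] I_def)
  have d_le: "d x * d x \<le> 2 * u n x + 2 * \<delta>\<^sup>2 * I x" for x
  proof (cases "x \<in> {0..L}")
    case True
    have "(indicator S x - q x)\<^sup>2 = ((indicator S x - f n x) + (f n x - q x))\<^sup>2" by simp
    also have "\<dots> \<le> 2 * (indicator S x - f n x)\<^sup>2 + 2 * (f n x - q x)\<^sup>2"
    proof -
      have "(a + b)\<^sup>2 \<le> 2 * a\<^sup>2 + 2 * b\<^sup>2" for a b :: real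
        using sum_squares_bound[of a b] by (simp add: power2_sum)
      then show ?thesis .
    qed
    also have "(f n x - q x)\<^sup>2 \<le> \<delta>\<^sup>2"
      using fq[of x] \<delta> by (simp add: abs_le_square_iff[symmetric])
    finally show ?thesis using True by (simp add: d u_def I_def power2_eq_square)
  next
    case False
    then show ?thesis by (simp add: d u_def I_def)
  qed
  have "L2_inner lebesgue d d \<le> (LINT x|lebesgue. 2 * u n x + 2 * \<delta>\<^sup>2 * I x)"
    unfolding L2_inner_def
  proof (rule integral_mono')
    show "integrable lebesgue (\<lambda>x. 2 * u n x + 2 * \<delta>\<^sup>2 * I x)"
      using u_int I_int by simp
    show "0 \<le> 2 * u n x + 2 * \<delta>\<^sup>2 * I x" for x by (simp add: u_def I_def)
  qed (rule d_le)
  also have "\<dots> = 2 * integral\<^sup>L lebesgue (u n) + 2 * (\<delta>\<^sup>2 * L)"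
    using u_int I_int L by (simp add: I_def)
  also have "\<dots> \<le> \<epsilon>\<^sup>2" using n \<delta>(2) by simp
  finally have "L2_inner lebesgue d d \<le> \<epsilon>\<^sup>2" .
  then show ?thesis
    using R sq unfolding d_def[abs_def] I_def \<omega>_def by blast
qed

lemma L2_norm_indicator_mult_le:
  fixes f :: "real \<Rightarrow> real"
  assumes "S \<in> lmeasurable" "\<And>x. x \<in> S \<Longrightarrow> \<bar>f x\<bar> \<le> c" "0 \<le> c"
  shows "sqrt (L2_inner lebesgue (\<lambda>x. indicator S x * f x) (\<lambda>x. indicator S x * f x)) \<le> c * sqrt (measure lebesgue S)"
proof -
  have "L2_inner lebesgue (\<lambda>x. indicator S x * f x) (\<lambda>x. indicator S x * f x)
      \<le> (LINT x|lebesgue. c\<^sup>2 * indicator S x)"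
    unfolding L2_inner_def
  proof (rule integral_mono')
    show "integrable lebesgue (\<lambda>x. c\<^sup>2 * indicat_real S x)"
      using assms(1) by (simp add: lmeasurable_iff_integrable)
    have "(f x)\<^sup>2 \<le> c\<^sup>2" if "x \<in> S" for x
      using assms(2)[OF that] assms(3) by (simp add: abs_le_square_iff[symmetric])
    then show "indicator S x * f x * (indicator S x * f x) \<le> c\<^sup>2 * indicator S x" for x
      by (simp add: indicator_def power2_eq_square)
  qed (simp add: indicator_def)
  also have "\<dots> = c\<^sup>2 * measure lebesgue S"
    using assms(1) by (simp add: fmeasurableD)
  finally have "sqrt (L2_inner lebesgue (\<lambda>x. indicator S x * f x) (\<lambda>x. indicator S x * f x))
      \<le> sqrt (c\<^sup>2 * measure lebesgue S)" by simp
  then show ?thesis using assms(3) by (simp add: real_sqrt_mult)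
qed

lemma cos_diff_le: "\<bar>cos x - cos y\<bar> \<le> \<bar>x - y\<bar>" for x y :: real
proof -
  have "\<bar>cos x - cos y\<bar> = 2 * (\<bar>sin ((x + y) / 2)\<bar> * \<bar>sin ((y - x) / 2)\<bar>)"
    by (simp add: cos_diff_cos abs_mult)
  also have "\<dots> \<le> 2 * (1 * \<bar>(y - x) / 2\<bar>)"
    by (intro mult_left_mono mult_mono abs_sin_x_le_abs_x) auto
  finally show ?thesis by simp
qed

text \<open>
  The long period \<open>L\<close> makes it possible to replace \<open>\<lambda>\<close> by a multiple of the fundamental frequency
  \<open>2 \<pi> / L\<close> at the cost of a small error on \<open>S\<close>.
\<close>

lemma oscillating_kernel_trig_approx:
  fixes \<kappa> :: "real \<Rightarrow> real"
  assumes S: "S \<in> sets lebesgue" "S \<subseteq> {0<..B}" and B: "B > 0"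
    and \<kappa>: "continuous_on {0..} \<kappa>" and m: "\<And>u. 0 \<le> u \<Longrightarrow> \<bar>\<kappa> u\<bar> \<le> m"
    and asymp: "((\<lambda>u. \<kappa> u - D * cos (u + \<theta>)) \<longlongrightarrow> 0) at_top"
    and \<epsilon>: "\<epsilon> > 0"
  shows "\<exists>L\<ge>2 * B. \<exists>R\<ge>0. \<exists>\<Lambda>. \<forall>l\<ge>\<Lambda>. \<exists>w.
    trig_span (2 * pi / L) {\<lfloor>l / (2 * pi / L)\<rfloor> - R..\<lfloor>l / (2 * pi / L)\<rfloor> + R} w \<and>
    L2_inner lebesgue (\<lambda>x. indicator S x * \<kappa> (l * x) - indicator {0..L} x * w x)
      (\<lambda>x. indicator S x * \<kappa> (l * x) - indicator {0..L} x * w x) \<le> \<epsilon>\<^sup>2"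
proof -
  have "bounded S"
    using S(2) by (intro bounded_subset[OF compact_imp_bounded[OF compact_Icc, of 0 B]]) auto
  then have SL: "S \<in> lmeasurable" using S(1) bounded_set_imp_lmeasurable by blast
  have mS: "measure lebesgue S \<le> B"
  proof -
    have "S \<subseteq> {0..B}" using S(2) by auto
    from measure_mono_fmeasurable[OF this S(1)] show ?thesis using B by simp
  qed
  \<comment> \<open>The first entry puts \<open>S\<close> into half a period; the second makes
    rounding a frequency to a multiple of \<open>\<omega>\<close> cost at most
    \<open>\<epsilon> / 3\<close>.\<close>
  define L where "L = max (2 * B) (6 * pi * \<bar>D\<bar> * B * sqrt B / \<epsilon>)"
  have L: "L \<ge> 2 * B" "L > 0" using B by (auto simp: L_def)
  define \<omega> where "\<omega> = 2 * pi / L"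
  have \<omega>: "\<omega> > 0" using L by (simp add: \<omega>_def)
  have \<omega>\<epsilon>: "\<bar>D\<bar> * (\<omega> * B) * sqrt B \<le> \<epsilon> / 3"
  proof -
    have "6 * pi * \<bar>D\<bar> * B * sqrt B / \<epsilon> \<le> L" by (simp add: L_def)
    then show ?thesis using \<epsilon> L by (simp add: \<omega>_def field_simps)
  qed
  \<comment> \<open>The summand 1 covers the case \<open>D = 0\<close>.\<close>
  define \<epsilon>1 where "\<epsilon>1 = \<epsilon> / (3 * (\<bar>D\<bar> + 1))"
  have \<epsilon>1: "\<epsilon>1 > 0" "\<bar>D\<bar> * \<epsilon>1 \<le> \<epsilon> / 3" using \<epsilon> by (simp_all add: \<epsilon>1_def field_simps)
  have "S \<subseteq> {0..L/2}" using S(2) L by fastforce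
  from indicator_trig_approx[OF S(1) this L(2) \<epsilon>1(1)] obtain R q where R: "R \<ge> 0"
    and q: "trig_span \<omega> {-R..R} q"
    and q_sq: "square_integrable lebesgue (\<lambda>x. indicator S x - indicator {0..L} x * q x)"
    and q_close: "L2_inner lebesgue (\<lambda>x. indicator S x - indicator {0..L} x * q x)
      (\<lambda>x. indicator S x - indicator {0..L} x * q x) \<le> \<epsilon>1\<^sup>2"
    unfolding \<omega>_def by blast
  define c where "c l x = D * cos (l * x + \<theta>)" for l x
  have c_le: "\<bar>c l x\<bar> \<le> \<bar>D\<bar>" for l x
    unfolding c_def abs_mult by (intro mult_left_le) auto
  define d1 where "d1 l x = indicator S x * (\<kappa> (l * x) - c l x)" for l x
  have cont: "continuous_on S (\<lambda>x. \<kappa> (l * x) - c l x)" if "0 \<le> l" for l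
    unfolding c_def
    by (intro continuous_intros continuous_on_compose2[OF \<kappa>]) (use that S(2) in auto)
  have d1_bound: "\<bar>\<kappa> (l * x) - c l x\<bar> \<le> m + \<bar>D\<bar>" if "0 \<le> l" "x \<in> S" for l x
    using m[of "l * x"] c_le[of l x] that S(2) by fastforce
  have d1_sq: "square_integrable lebesgue (d1 l)" if "0 \<le> l" for l
    unfolding d1_def using that d1_bound[OF that]
    by (intro square_integrable_indicator_mult[OF SL] continuous_imp_measurable_on_sets_lebesgue cont S(1))
  \<comment> \<open>The set \<open>S\<close> may accumulate at 0, where \<open>l * x\<close> stays
    small, so the sinusoid is not approached uniformly on \<open>S\<close>; hence dominated
    convergence. The absolute value keeps the argument of \<kappa> nonnegative on \<open>S\<close>
    for every \<open>l\<close>, since measurability is demanded for all of them.\<close>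
  have "((\<lambda>l. LINT x|lebesgue. (d1 \<bar>l\<bar> x)\<^sup>2) \<longlongrightarrow> integral\<^sup>L lebesgue (\<lambda>x::real. 0)) at_top"
  proof (rule integral_dominated_convergence_at_top[where w = "\<lambda>x. (m + \<bar>D\<bar>)\<^sup>2 * indicator S x"])
    show "(\<lambda>x. (d1 \<bar>l\<bar> x)\<^sup>2) \<in> borel_measurable lebesgue" for l
      using d1_sq[of "\<bar>l\<bar>"] by (auto simp: square_integrable_def)
    show "integrable lebesgue (\<lambda>x. (m + \<bar>D\<bar>)\<^sup>2 * indicat_real S x)"
      using SL by (simp add: lmeasurable_iff_integrable)
    have "(d1 \<bar>l\<bar> x)\<^sup>2 \<le> (m + \<bar>D\<bar>)\<^sup>2 * indicator S x" for l x
    proof (cases "x \<in> S")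
      case True
      have "(\<kappa> (\<bar>l\<bar> * x) - c \<bar>l\<bar> x)\<^sup>2 \<le> (m + \<bar>D\<bar>)\<^sup>2"
        using d1_bound[of "\<bar>l\<bar>" x] True by (meson abs_ge_zero abs_le_square_iff order_trans power2_le_iff_abs_le)
      then show ?thesis using True by (simp add: d1_def)
    qed (simp add: d1_def)
    then show "\<forall>\<^sub>F l in at_top. AE x in lebesgue. norm ((d1 \<bar>l\<bar> x)\<^sup>2) \<le> (m + \<bar>D\<bar>)\<^sup>2 * indicator S x"
      by simp
    have "((\<lambda>l. (d1 \<bar>l\<bar> x)\<^sup>2) \<longlongrightarrow> 0) at_top" for x
    proof (cases "x \<in> S")
      case True
      then have "x > 0" using S(2) by auto
      then have "filterlim (\<lambda>l. l * x) at_top at_top"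
        by (intro filterlim_at_top_mult_tendsto_pos[OF tendsto_const] filterlim_ident)
      from filterlim_compose[OF asymp this]
      have "((\<lambda>l. \<kappa> (l * x) - c l x) \<longlongrightarrow> 0) at_top" by (simp add: c_def)
      then have "((\<lambda>l. (\<kappa> (l * x) - c l x)\<^sup>2) \<longlongrightarrow> 0\<^sup>2) at_top" by (intro tendsto_power)
      moreover have "\<forall>\<^sub>F l in at_top. (\<kappa> (l * x) - c l x)\<^sup>2 = (d1 \<bar>l\<bar> x)\<^sup>2"
        using eventually_ge_at_top[of 0] by eventually_elim (simp add: d1_def True)
      ultimately show ?thesis by (simp add: tendsto_cong)
    qed (simp add: d1_def)
    then show "AE x in lebesgue. ((\<lambda>l. (d1 \<bar>l\<bar> x)\<^sup>2) \<longlongrightarrow> 0) at_top" by simp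
  qed simp
  then have "\<forall>\<^sub>F l in at_top. (LINT x|lebesgue. (d1 \<bar>l\<bar> x)\<^sup>2) < (\<epsilon> / 3)\<^sup>2"
    using \<epsilon> by (intro order_tendstoD) auto
  then obtain \<Lambda> where \<Lambda>: "\<And>l. l \<ge> \<Lambda> \<Longrightarrow> (LINT x|lebesgue. (d1 \<bar>l\<bar> x)\<^sup>2) < (\<epsilon> / 3)\<^sup>2"
    by (auto simp: eventually_at_top_linorder)
  show ?thesis
  proof (intro exI conjI allI impI)
    fix l assume l: "l \<ge> max \<Lambda> 0"
    define k where "k = \<lfloor>l / \<omega>\<rfloor>"
    have "l / \<omega> - 1 \<le> of_int k" "of_int k \<le> l / \<omega>" unfolding k_def by linarith+
    then have k: "\<bar>l - of_int k * \<omega>\<bar> \<le> \<omega>" using \<omega> by (simp add: field_simps)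
    define w where "w x = D * (q x * cos (of_int k * \<omega> * x + \<theta>))" for x
    show "trig_span (2 * pi / L) {\<lfloor>l / (2 * pi / L)\<rfloor> - R..\<lfloor>l / (2 * pi / L)\<rfloor> + R} w"
      unfolding \<omega>_def[symmetric] k_def[symmetric] w_def
      by (intro trig_span_cmult trig_span_mult_cos q)
    \<comment> \<open>The error splits in three: \<open>d1\<close> passes from \<kappa> to the
      sinusoid, \<open>d2\<close> rounds its frequency, and \<open>d3\<close> replaces the indicator
      of \<open>S\<close> by \<open>q\<close>. Only \<open>d3\<close> extends beyond
      \<open>S\<close>.\<close>
    define d2 where "d2 x = indicator S x * (c l x - c (of_int k * \<omega>) x)" for x
    define d3 where "d3 x = c (of_int k * \<omega>) x * (indicator S x - indicator {0..L} x * q x)" for x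
    have d1_small: "sqrt (L2_inner lebesgue (d1 l) (d1 l)) \<le> \<epsilon> / 3"
    proof -
      have "L2_inner lebesgue (d1 l) (d1 l) \<le> (\<epsilon> / 3)\<^sup>2"
        using \<Lambda>[of l] l by (simp add: L2_inner_def power2_eq_square)
      then show ?thesis using \<epsilon> by (intro real_le_lsqrt) (auto simp: L2_inner_nonneg)
    qed
    have d2_bound: "\<bar>c l x - c (of_int k * \<omega>) x\<bar> \<le> \<bar>D\<bar> * (\<omega> * B)" if "x \<in> S" for x
    proof -
      have "\<bar>c l x - c (of_int k * \<omega>) x\<bar> = \<bar>D\<bar> * \<bar>cos (l * x + \<theta>) - cos (of_int k * \<omega> * x + \<theta>)\<bar>"
        by (simp add: c_def right_diff_distrib[symmetric] abs_mult)
      also have "\<dots> \<le> \<bar>D\<bar> * \<bar>(l * x + \<theta>) - (of_int k * \<omega> * x + \<theta>)\<bar>"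
        by (intro mult_left_mono cos_diff_le) auto
      also have "(l * x + \<theta>) - (of_int k * \<omega> * x + \<theta>) = (l - of_int k * \<omega>) * x"
        by (simp add: algebra_simps)
      also have "\<bar>D\<bar> * \<bar>(l - of_int k * \<omega>) * x\<bar> \<le> \<bar>D\<bar> * (\<omega> * B)"
        unfolding abs_mult using k that S(2) \<omega> by (intro mult_left_mono mult_mono) auto
      finally show ?thesis .
    qed
    have d2_sq: "square_integrable lebesgue d2"
      unfolding d2_def
    proof (rule square_integrable_indicator_mult[OF SL _ d2_bound])
      show "(\<lambda>x. c l x - c (of_int k * \<omega>) x) \<in> borel_measurable (lebesgue_on S)"
        unfolding c_def by (intro continuous_imp_measurable_on_sets_lebesgue continuous_intros S(1))
    qed
    have d2_small: "sqrt (L2_inner lebesgue d2 d2) \<le> \<epsilon> / 3"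
    proof -
      have "sqrt (L2_inner lebesgue d2 d2) \<le> \<bar>D\<bar> * (\<omega> * B) * sqrt (measure lebesgue S)"
        unfolding d2_def using \<omega> B d2_bound by (intro L2_norm_indicator_mult_le SL) auto
      also have "\<dots> \<le> \<bar>D\<bar> * (\<omega> * B) * sqrt B"
        using mS \<omega> B by (intro mult_left_mono) auto
      finally show ?thesis using \<omega>\<epsilon> by simp
    qed
    define p where "p x = indicator S x - indicator {0..L} x * q x" for x
    have c_meas: "c (of_int k * \<omega>) \<in> borel_measurable lebesgue"
    proof -
      have "continuous_on UNIV (c (of_int k * \<omega>))" unfolding c_def by (intro continuous_intros)
      then show ?thesis using continuous_imp_measurable_on_sets_lebesgue[of UNIV] by (simp add: lebesgue_on_UNIV_eq)
    qed
    have d3_le: "d3 x * d3 x \<le> D\<^sup>2 * (p x * p x)" for x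
    proof -
      have "(c (of_int k * \<omega>) x)\<^sup>2 \<le> D\<^sup>2"
        using c_le[of "of_int k * \<omega>" x] by (simp add: abs_le_square_iff)
      then have "(c (of_int k * \<omega>) x)\<^sup>2 * (p x * p x) \<le> D\<^sup>2 * (p x * p x)"
        by (intro mult_right_mono) auto
      moreover have "d3 x = c (of_int k * \<omega>) x * p x" by (simp add: d3_def p_def)
      ultimately show ?thesis by (simp only: power2_eq_square mult_ac)
    qed
    have p_int: "integrable lebesgue (\<lambda>x. D\<^sup>2 * (p x * p x))"
      using square_integrable_mult[OF q_sq q_sq] by (simp add: p_def)
    have d3_sq: "square_integrable lebesgue d3"
      unfolding square_integrable_def
    proof
      show meas: "d3 \<in> borel_measurable lebesgue"
        unfolding d3_def[abs_def] using c_meas q_sq by (auto simp: square_integrable_def)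
      show "integrable lebesgue (\<lambda>x. (d3 x)\<^sup>2)"
      proof (rule Bochner_Integration.integrable_bound[OF p_int])
        show "(\<lambda>x. (d3 x)\<^sup>2) \<in> borel_measurable lebesgue" using meas by measurable
        show "AE x in lebesgue. norm ((d3 x)\<^sup>2) \<le> norm (D\<^sup>2 * (p x * p x))"
          using d3_le by (simp add: power2_eq_square)
      qed
    qed
    have d3_small: "sqrt (L2_inner lebesgue d3 d3) \<le> \<epsilon> / 3"
    proof -
      have "L2_inner lebesgue d3 d3 \<le> (LINT x|lebesgue. D\<^sup>2 * (p x * p x))"
        unfolding L2_inner_def by (intro integral_mono' p_int d3_le) auto
      also have "\<dots> = D\<^sup>2 * L2_inner lebesgue p p" by (simp add: L2_inner_def)
      also have "\<dots> \<le> D\<^sup>2 * \<epsilon>1\<^sup>2"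
        using q_close by (intro mult_left_mono) (auto simp: p_def[abs_def])
      also have "\<dots> = (\<bar>D\<bar> * \<epsilon>1)\<^sup>2" by (simp add: power_mult_distrib)
      finally have "sqrt (L2_inner lebesgue d3 d3) \<le> \<bar>D\<bar> * \<epsilon>1"
        using \<epsilon>1 by (intro real_le_lsqrt) (auto simp: L2_inner_nonneg)
      then show ?thesis using \<epsilon>1 by simp
    qed
    define d where "d x = d1 l x + d2 x + d3 x" for x
    have "sqrt (L2_inner lebesgue d d)
        \<le> sqrt (L2_inner lebesgue (\<lambda>x. d1 l x + d2 x) (\<lambda>x. d1 l x + d2 x)) + sqrt (L2_inner lebesgue d3 d3)"
      unfolding d_def using d1_sq[of l] l d2_sq d3_sq by (intro L2_norm_triangle square_integrable_add) auto
    also have "sqrt (L2_inner lebesgue (\<lambda>x. d1 l x + d2 x) (\<lambda>x. d1 l x + d2 x))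
        \<le> sqrt (L2_inner lebesgue (d1 l) (d1 l)) + sqrt (L2_inner lebesgue d2 d2)"
      using d1_sq[of l] l d2_sq by (intro L2_norm_triangle) auto
    finally have "sqrt (L2_inner lebesgue d d) \<le> \<epsilon>" using d1_small d2_small d3_small by simp
    then have "L2_inner lebesgue d d \<le> \<epsilon>\<^sup>2" by (rule sqrt_le_D)
    moreover have "d = (\<lambda>x. indicator S x * \<kappa> (l * x) - indicator {0..L} x * w x)"
      by (auto simp: d_def d1_def d2_def d3_def w_def c_def fun_eq_iff algebra_simps)
    ultimately show "L2_inner lebesgue (\<lambda>x. indicator S x * \<kappa> (l * x) - indicator {0..L} x * w x)
        (\<lambda>x. indicator S x * \<kappa> (l * x) - indicator {0..L} x * w x) \<le> \<epsilon>\<^sup>2" by simp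
  qed (use L R in auto)
qed

section \<open>Counting points\<close>

text \<open>Evaluation at \<open>t n\<close> is the pairing of the Hankel transform with the kernel
  on \<open>S\<close>, so interpolation is a moment problem for square-integrable functions.\<close>

lemma hankel_space_moment:
  assumes S: "S \<in> sets lebesgue" "S \<subseteq> {0<..}"
    and t: "\<And>n. t n > 0" and interp: "interpolation_set \<alpha> S t"
    and a: "summable (\<lambda>n. (a n)\<^sup>2)"
    and e: "\<And>n. square_integrable lebesgue (\<lambda>x. indicator S x * (sqrt (t n * x) * bessel_J \<alpha> (t n * x)))"
  shows "\<exists>g. square_integrable lebesgue g \<and>
    (\<forall>n. L2_inner lebesgue (\<lambda>x. indicator S x * (sqrt (t n * x) * bessel_J \<alpha> (t n * x))) g = a n)"
proof -
  have "\<exists>f \<in> hankel_space \<alpha> S. \<forall>n. f (t n) = complex_of_real (a n)"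
    using interp[unfolded interpolation_set_def, rule_format, of "\<lambda>n. complex_of_real (a n)"] a by simp
  then obtain f where f: "f \<in> hankel_space \<alpha> S" and fa: "\<And>n. f (t n) = complex_of_real (a n)"
    by blast
  then obtain g where "has_hankel_transform \<alpha> f g"
    and fg: "\<And>s. s > 0 \<Longrightarrow> f s = (LINT x|lebesgue_on S. hankel_kernel \<alpha> s x *\<^sub>R g x)"
    unfolding hankel_space_def by blast
  then have g: "g \<in> borel_measurable (lebesgue_on {0<..})"
      "integrable (lebesgue_on {0<..}) (\<lambda>x. (norm (g x))\<^sup>2)"
    unfolding has_hankel_transform_def L2_half_line_def by auto
  define h where "h x = indicator S x *\<^sub>R g x" for x
  \<comment> \<open>Measurability of \<open>g\<close> is known on the half-line only; inserting its
    indicator transfers it to the whole line.\<close>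
  have h_alt: "h x = indicator S x *\<^sub>R (indicator {0<..} x *\<^sub>R g x)" for x
    using S(2) by (auto simp: h_def indicator_def)
  have h_meas: "h \<in> borel_measurable lebesgue"
  proof -
    have "(\<lambda>x. indicator {0<..} x *\<^sub>R g x) \<in> borel_measurable lebesgue"
      using g(1) borel_measurable_restrict_space_iff[of "{0<..}" lebesgue g] by simp
    then show ?thesis
      unfolding h_alt[abs_def] by (rule borel_measurable_scaleR[OF borel_measurable_indicator[OF S(1)]])
  qed
  have h_int: "integrable lebesgue (\<lambda>x. (norm (h x))\<^sup>2)"
  proof (rule Bochner_Integration.integrable_bound)
    show "integrable lebesgue (\<lambda>x. indicator {0<..} x *\<^sub>R (norm (g x))\<^sup>2)"
      using g(2) by (subst (asm) integrable_restrict_space) auto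
    show "(\<lambda>x. (norm (h x))\<^sup>2) \<in> borel_measurable lebesgue" using h_meas by measurable
    show "AE x in lebesgue. norm ((norm (h x))\<^sup>2) \<le> norm (indicator {0<..} x *\<^sub>R (norm (g x))\<^sup>2)"
      using S(2) by (intro AE_I2) (auto simp: h_def indicator_def)
  qed
  have h_sq: "square_integrable lebesgue (\<lambda>x. norm (h x))"
    using h_meas h_int by (simp add: square_integrable_def)
  have "square_integrable lebesgue (\<lambda>x. Re (h x))"
    unfolding square_integrable_def
  proof
    show meas: "(\<lambda>x. Re (h x)) \<in> borel_measurable lebesgue" using h_meas by measurable
    show "integrable lebesgue (\<lambda>x. (Re (h x))\<^sup>2)"
    proof (rule Bochner_Integration.integrable_bound[OF h_int])
      show "(\<lambda>x. (Re (h x))\<^sup>2) \<in> borel_measurable lebesgue" using meas by measurable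
      show "AE x in lebesgue. norm ((Re (h x))\<^sup>2) \<le> norm ((norm (h x))\<^sup>2)"
        by (intro AE_I2) (simp add: cmod_power2)
    qed
  qed
  moreover have "L2_inner lebesgue (\<lambda>x. indicator S x * (sqrt (t n * x) * bessel_J \<alpha> (t n * x))) (\<lambda>x. Re (h x)) = a n" for n
  proof -
    define k where "k x = indicator S x * (sqrt (t n * x) * bessel_J \<alpha> (t n * x))" for x
    have k: "square_integrable lebesgue k" unfolding k_def by (rule e)
    have int: "integrable lebesgue (\<lambda>x. k x *\<^sub>R h x)"
    proof (rule Bochner_Integration.integrable_bound[OF square_integrable_mult[OF k h_sq]])
      show "(\<lambda>x. k x *\<^sub>R h x) \<in> borel_measurable lebesgue"
        using k h_meas by (intro borel_measurable_scaleR) (auto simp: square_integrable_def)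
    qed (simp add: abs_mult)
    have "a n = Re (f (t n))" by (simp add: fa)
    also have "f (t n) = (LINT x|lebesgue. indicator S x *\<^sub>R (hankel_kernel \<alpha> (t n) x *\<^sub>R g x))"
      using fg[OF t] S(1) by (simp add: integral_restrict_space)
    also have "(\<lambda>x. indicator S x *\<^sub>R (hankel_kernel \<alpha> (t n) x *\<^sub>R g x)) = (\<lambda>x. k x *\<^sub>R h x)"
      by (auto simp: hankel_kernel_def k_def h_def indicator_def)
    also have "Re (LINT x|lebesgue. k x *\<^sub>R h x) = (LINT x|lebesgue. Re (k x *\<^sub>R h x))"
      using int by (rule integral_Re[symmetric])
    also have "\<dots> = L2_inner lebesgue k (\<lambda>x. Re (h x))" by (simp add: L2_inner_def)
    finally show ?thesis by (simp add: k_def[abs_def])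
  qed
  ultimately show ?thesis by blast
qed

text \<open>Infinitely many points below \<open>b\<close> would accumulate, and uniform continuity
  of \<kappa> would bring two of the functions so close that \<open>C\<close> times their squared
  distance is at most 1, whereas the Riesz bound with coefficients 1 and -1 makes it at least
  2.\<close>

lemma finite_points_of_riesz_bound:
  fixes \<kappa> :: "real \<Rightarrow> real" and t :: "nat \<Rightarrow> real"
  assumes S: "S \<in> lmeasurable" "S \<subseteq> {0<..B}" and B: "B > 0"
    and \<kappa>: "continuous_on {0..} \<kappa>" and t: "inj t" "\<And>n. t n > 0"
    and C: "C > 0" and riesz: "\<And>F c. finite F \<Longrightarrow> (\<Sum>i\<in>F. (c i)\<^sup>2)
      \<le> C * L2_inner lebesgue (\<lambda>x. \<Sum>i\<in>F. c i * (indicator S x * \<kappa> (t i * x)))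
             (\<lambda>x. \<Sum>i\<in>F. c i * (indicator S x * \<kappa> (t i * x)))"
  shows "finite {n. t n \<le> b}"
proof (rule ccontr)
  assume inf: "infinite {n. t n \<le> b}"
  then obtain n0 where "t n0 \<le> b" using not_finite_existsD by blast
  then have b: "b > 0" using t(2)[of n0] by simp
  \<comment> \<open>The summand 1 avoids division by zero when \<open>S\<close> is a null
    set.\<close>
  define \<eta> where "\<eta> = 1 / (sqrt C * sqrt (measure lebesgue S + 1))"
  have mS: "0 \<le> measure lebesgue S" by simp
  have \<eta>: "\<eta> > 0" using C mS by (simp add: \<eta>_def add_nonneg_pos)
  have "uniformly_continuous_on {0..b * B} \<kappa>"
    by (intro compact_uniformly_continuous continuous_on_subset[OF \<kappa>]) auto
  then obtain \<delta> where \<delta>: "\<delta> > 0"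
    and \<kappa>_close: "\<And>u v. u \<in> {0..b * B} \<Longrightarrow> v \<in> {0..b * B} \<Longrightarrow> \<bar>u - v\<bar> < \<delta> \<Longrightarrow> \<bar>\<kappa> u - \<kappa> v\<bar> < \<eta>"
    using \<eta> unfolding uniformly_continuous_on_def dist_real_def by metis
  have "infinite (t ` {n. t n \<le> b})"
    using inf t(1) by (meson finite_imageD inj_on_subset subset_UNIV)
  moreover have "t ` {n. t n \<le> b} \<subseteq> {0..b}" using less_imp_le[OF t(2)] by auto
  ultimately obtain x where x: "x islimpt (t ` {n. t n \<le> b})"
    using Heine_Borel_imp_Bolzano_Weierstrass[OF compact_Icc] by metis
  define \<gamma> where "\<gamma> = \<delta> / (2 * B)"
  have \<gamma>: "\<gamma> > 0" using \<delta> B by (simp add: \<gamma>_def)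
  obtain i where i: "t i \<le> b" "t i \<noteq> x" "dist (t i) x < \<gamma>"
    using x \<gamma> unfolding islimpt_approachable by blast
  \<comment> \<open>Asking for a point strictly nearer to the limit than \<open>t i\<close>
    guarantees \<open>j \<noteq> i\<close>.\<close>
  have "0 < min \<gamma> (dist (t i) x)" using \<gamma> i(2) by simp
  then obtain j where j: "t j \<le> b" "t j \<noteq> x" "dist (t j) x < min \<gamma> (dist (t i) x)"
    using x unfolding islimpt_approachable by blast
  have ij: "i \<noteq> j" using j by auto
  have "\<bar>t i - t j\<bar> < 2 * \<gamma>" using i j by (simp add: dist_real_def)
  then have close: "\<bar>t i - t j\<bar> * B < \<delta>" using B by (simp add: \<gamma>_def field_simps)
  have bound: "\<bar>\<kappa> (t i * x) - \<kappa> (t j * x)\<bar> \<le> \<eta>" if "x \<in> S" for x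
  proof -
    have x: "0 < x" "x \<le> B" using that S(2) by auto
    have "\<bar>t i * x - t j * x\<bar> = \<bar>t i - t j\<bar> * x"
      using x by (simp add: left_diff_distrib[symmetric] abs_mult)
    also have "\<dots> \<le> \<bar>t i - t j\<bar> * B" using x by (intro mult_left_mono) auto
    finally have "\<bar>t i * x - t j * x\<bar> < \<delta>" using close by linarith
    moreover have "t k * x \<in> {0..b * B}" if "t k \<le> b" for k
      using that x b t(2)[of k] by (auto intro: mult_mono)
    ultimately show ?thesis using \<kappa>_close[of "t i * x" "t j * x"] i j by simp
  qed
  define d where "d x = indicator S x * (\<kappa> (t i * x) - \<kappa> (t j * x))" for x
  have "sqrt (L2_inner lebesgue d d) \<le> \<eta> * sqrt (measure lebesgue S)"
    unfolding d_def using bound \<eta> by (intro L2_norm_indicator_mult_le S(1)) auto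
  then have "L2_inner lebesgue d d \<le> (\<eta> * sqrt (measure lebesgue S))\<^sup>2"
    using sqrt_le_D by blast
  also have "\<dots> = \<eta>\<^sup>2 * measure lebesgue S" by (simp add: power_mult_distrib)
  also have "\<dots> \<le> \<eta>\<^sup>2 * (measure lebesgue S + 1)" by (simp add: distrib_left)
  also have "\<dots> = 1 / C"
  proof -
    have "(1 / (sqrt C * sqrt v))\<^sup>2 * v = 1 / C" if "v > 0" for v
      using C that by (simp add: power_mult_distrib power_divide)
    moreover have "measure lebesgue S + 1 > 0" using mS by linarith
    ultimately show ?thesis unfolding \<eta>_def by blast
  qed
  finally have "C * L2_inner lebesgue d d \<le> 1" using C by (simp add: field_simps)
  moreover define c where "c k = (if k = i then 1 else -1 :: real)" for k
  have "d = (\<lambda>x. \<Sum>k\<in>{i, j}. c k * (indicator S x * \<kappa> (t k * x)))"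
    using ij by (auto simp: d_def c_def fun_eq_iff right_diff_distrib)
  then have "(\<Sum>k\<in>{i, j}. (c k)\<^sup>2) \<le> C * L2_inner lebesgue d d"
    using riesz[of "{i, j}" c] by simp
  then have "2 \<le> C * L2_inner lebesgue d d" using ij by (simp add: c_def)
  ultimately show False by simp
qed

text \<open>The left-hand side is the real part of \<open>Complex b (- a) * cis u\<close>.\<close>

lemma polar_form_cos_sin: "\<exists>D \<theta>. \<forall>u. a * sin u + b * cos u = D * cos (u + \<theta>)" for a b :: real
proof -
  obtain D \<theta> where "Complex b (- a) = rcis D \<theta>" using rcis_Ex by blast
  then have "b = D * cos \<theta>" "- a = D * sin \<theta>" by (simp_all add: complex_eq_iff)
  then have "a = - (D * sin \<theta>)" "b = D * cos \<theta>" by linarith+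
  then show ?thesis by (intro exI[of _ D] exI[of _ \<theta>]) (simp add: cos_add algebra_simps)
qed

text \<open>The trace estimate for the points beyond a threshold. The constant \<open>K\<close>
  collects the points below it and the frequencies by which the band exceeds the window, so it
  depends on neither \<open>a\<close> nor \<open>r\<close>.\<close>

lemma card_points_le:
  fixes \<kappa> :: "real \<Rightarrow> real" and t :: "nat \<Rightarrow> real"
  assumes S: "S \<in> sets lebesgue" "S \<subseteq> {0<..B}" and B: "B > 0"
    and \<kappa>: "continuous_on {0..} \<kappa>" and m: "\<And>u. 0 \<le> u \<Longrightarrow> \<bar>\<kappa> u\<bar> \<le> m"
    and asymp: "((\<lambda>u. \<kappa> u - D * cos (u + \<theta>)) \<longlongrightarrow> 0) at_top"
    and e: "\<And>n. square_integrable lebesgue (\<lambda>x. indicator S x * \<kappa> (t n * x))"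
    and C: "C > 0" and riesz: "\<And>F c. finite F \<Longrightarrow> (\<Sum>i\<in>F. (c i)\<^sup>2)
      \<le> C * L2_inner lebesgue (\<lambda>x. \<Sum>i\<in>F. c i * (indicator S x * \<kappa> (t i * x)))
             (\<lambda>x. \<Sum>i\<in>F. c i * (indicator S x * \<kappa> (t i * x)))"
    and fin: "\<And>b. finite {n. t n \<le> b}" and \<eta>: "0 < \<eta>" "\<eta> < 1"
  shows "\<exists>K. \<forall>a\<ge>0. \<forall>r\<ge>0. real (card {n. t n \<in> {a..a + r}}) * (1 - \<eta>) \<le> measure lebesgue S / pi * r + K"
proof -
  have "bounded S"
    using S(2) by (intro bounded_subset[OF compact_imp_bounded[OF compact_Icc, of 0 B]]) auto
  then have SL: "S \<in> lmeasurable" using S(1) bounded_set_imp_lmeasurable by blast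
  define \<epsilon> where "\<epsilon> = \<eta> / sqrt C"
  have \<epsilon>: "\<epsilon> > 0" "\<epsilon> * sqrt C = \<eta>" using C \<eta> by (simp_all add: \<epsilon>_def)
  from oscillating_kernel_trig_approx[OF S B \<kappa> m asymp \<epsilon>(1)] obtain L R \<Lambda> where
    L: "L \<ge> 2 * B" and R: "R \<ge> 0" and approx: "\<And>l. l \<ge> \<Lambda> \<Longrightarrow> \<exists>w.
      trig_span (2 * pi / L) {\<lfloor>l / (2 * pi / L)\<rfloor> - R..\<lfloor>l / (2 * pi / L)\<rfloor> + R} w \<and>
      L2_inner lebesgue (\<lambda>x. indicator S x * \<kappa> (l * x) - indicator {0..L} x * w x)
        (\<lambda>x. indicator S x * \<kappa> (l * x) - indicator {0..L} x * w x) \<le> \<epsilon>\<^sup>2"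
    by blast
  have L0: "L > 0" using L B by simp
  have SL': "S \<subseteq> {0..L}" using S(2) L B by fastforce
  define \<omega> where "\<omega> = 2 * pi / L"
  have \<omega>: "\<omega> > 0" using L0 by (simp add: \<omega>_def)
  \<comment> \<open>The second entry keeps every frequency of the band \<open>J\<close> positive,
    even after lowering its start by \<open>R\<close>.\<close>
  define \<Lambda>1 where "\<Lambda>1 = max \<Lambda> ((of_int R + 2) * \<omega>)"
  define N where "N = real (card {n. t n \<le> \<Lambda>1})"
  define \<mu> where "\<mu> = 2 * measure lebesgue S / L"
  have \<mu>: "\<mu> \<ge> 0" using L0 by (simp add: \<mu>_def)
  have "real (card {n. t n \<in> {a..a + r}}) * (1 - \<eta>)
      \<le> measure lebesgue S / pi * r + (N + (2 * of_int R + 2) * \<mu>)" if "a \<ge> 0" "r \<ge> 0" for a r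
  proof -
    define F where "F = {n. t n \<in> {a..a + r}}"
    define F2 where "F2 = {n \<in> F. \<Lambda>1 < t n}"
    have "F \<subseteq> {n. t n \<le> a + r}" by (auto simp: F_def)
    then have finF: "finite F" using fin finite_subset by blast
    then have finF2: "finite F2" by (simp add: F2_def)
    have "F \<subseteq> {n. t n \<le> \<Lambda>1} \<union> F2" by (auto simp: F2_def)
    then have "card F \<le> card ({n. t n \<le> \<Lambda>1} \<union> F2)" using fin finF2 by (intro card_mono) auto
    also have "\<dots> \<le> card {n. t n \<le> \<Lambda>1} + card F2" by (rule card_Un_le)
    finally have cardF: "real (card F) \<le> N + real (card F2)" by (simp add: N_def)
    define b where "b = max a \<Lambda>1"
    define J where "J = {\<lfloor>b / \<omega>\<rfloor> - R..\<lfloor>(a + r) / \<omega>\<rfloor> + R}"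
    have J_pos: "j > 0" if "j \<in> J" for j
    proof -
      have "of_int R + 2 \<le> b / \<omega>" using \<omega> by (simp add: b_def \<Lambda>1_def field_simps)
      then have "R + 2 \<le> \<lfloor>b / \<omega>\<rfloor>" by (simp add: le_floor_iff)
      then show ?thesis using that by (simp add: J_def)
    qed
    \<comment> \<open>Rounding the two ends costs at most one frequency, and counting both of them
      another. The maximum with 0 covers an empty band, when the window lies well below the
      threshold.\<close>
    have cardJ: "real (card J) \<le> r / \<omega> + 2 * of_int R + 2"
    proof -
      have "a / \<omega> \<le> b / \<omega>" using \<omega> by (simp add: b_def divide_right_mono)
      moreover have "(a + r) / \<omega> = a / \<omega> + r / \<omega>" by (simp add: add_divide_distrib)
      moreover have "0 \<le> r / \<omega>" using that \<omega> by simp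
      moreover have "real (card J) = max 0 (of_int (\<lfloor>(a + r) / \<omega>\<rfloor> + R - (\<lfloor>b / \<omega>\<rfloor> - R) + 1))"
      proof -
        have "real (nat z) = max 0 (of_int z)" for z by (cases "0 \<le> z") auto
        then show ?thesis by (simp add: J_def)
      qed
      ultimately show ?thesis using R by linarith
    qed
    have "real (card F2) * (1 - \<epsilon> * sqrt C)
        \<le> (\<Sum>i\<in>J \<times> UNIV. L2_inner lebesgue (\<lambda>x. indicator S x * trig_basis L i x)
            (\<lambda>x. indicator S x * trig_basis L i x))"
    proof (rule card_le_of_concentration[where e = "\<lambda>n x. indicator S x * \<kappa> (t n * x)" and \<phi> = "trig_basis L"])
      show "\<exists>c. L2_inner lebesgue (\<lambda>x. indicator S x * \<kappa> (t n * x) - (\<Sum>i\<in>J \<times> UNIV. c i * trig_basis L i x))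
          (\<lambda>x. indicator S x * \<kappa> (t n * x) - (\<Sum>i\<in>J \<times> UNIV. c i * trig_basis L i x)) \<le> \<epsilon>\<^sup>2"
        if n: "n \<in> F2" for n
      proof -
        have tn: "\<Lambda>1 \<le> t n" "b \<le> t n" "t n \<le> a + r" using n by (auto simp: F2_def F_def b_def)
        obtain w where w: "trig_span \<omega> {\<lfloor>t n / \<omega>\<rfloor> - R..\<lfloor>t n / \<omega>\<rfloor> + R} w"
          and w_close: "L2_inner lebesgue (\<lambda>x. indicator S x * \<kappa> (t n * x) - indicator {0..L} x * w x)
            (\<lambda>x. indicator S x * \<kappa> (t n * x) - indicator {0..L} x * w x) \<le> \<epsilon>\<^sup>2"
          using approx[of "t n"] tn(1) unfolding \<omega>_def[symmetric] by (auto simp: \<Lambda>1_def)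
        have "\<lfloor>b / \<omega>\<rfloor> \<le> \<lfloor>t n / \<omega>\<rfloor>" "\<lfloor>t n / \<omega>\<rfloor> \<le> \<lfloor>(a + r) / \<omega>\<rfloor>"
          using tn \<omega> by (auto intro!: floor_mono divide_right_mono)
        then have "trig_span \<omega> J w" by (intro trig_span_mono[OF w]) (auto simp: J_def)
        then obtain c where "\<And>x. indicator {0..L} x * w x = (\<Sum>i\<in>J \<times> UNIV. c i * trig_basis L i x)"
          using trig_span_expansion[of L J w] L0 unfolding \<omega>_def J_def by auto
        then show ?thesis using w_close by (intro exI[of _ c]) simp
      qed
      show "L2_inner lebesgue (trig_basis L i) (trig_basis L k) = of_bool (i = k)"
        if "i \<in> J \<times> UNIV" "k \<in> J \<times> UNIV" for i k
        using that J_pos L0 by (intro trig_basis_orthonormal) auto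
      show "square_integrable lebesgue (\<lambda>x. indicator S x * trig_basis L i x)" for i
      proof -
        have "trig_basis L i \<in> borel_measurable lebesgue"
          using square_integrable_trig_basis[OF L0] by (simp add: square_integrable_def)
        then have "trig_basis L i \<in> borel_measurable (lebesgue_on S)"
          by (rule measurable_restrict_space1)
        moreover have "\<bar>trig_basis L i x\<bar> \<le> \<bar>sqrt (2 / L)\<bar>" for x
          unfolding trig_basis_def abs_mult by (auto simp: indicator_def intro!: mult_left_le)
        ultimately show ?thesis by (intro square_integrable_indicator_mult[OF SL])
      qed
      \<comment> \<open>The functions vanish off \<open>S\<close>, so they only feel the restriction
        of the basis to \<open>S\<close>; the upper bound thus involves its energy on
        \<open>S\<close> instead of its norm 1.\<close>
      show "L2_inner lebesgue (\<lambda>x. indicator S x * \<kappa> (t n * x)) (trig_basis L i)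
          = L2_inner lebesgue (\<lambda>x. indicator S x * \<kappa> (t n * x)) (\<lambda>x. indicator S x * trig_basis L i x)" for n i
        unfolding L2_inner_def by (intro Bochner_Integration.integral_cong) (auto simp: indicator_def)
    qed (use finF2 e C riesz square_integrable_trig_basis[OF L0] \<epsilon> in \<open>auto simp: J_def\<close>)
    also have "\<dots> = real (card J) * \<mu>"
      unfolding \<mu>_def by (intro trig_basis_restrict_sum SL SL' L0) (simp add: J_def)
    also have "\<dots> \<le> (r / \<omega> + 2 * of_int R + 2) * \<mu>"
      using cardJ \<mu> by (intro mult_right_mono)
    \<comment> \<open>The period cancels: the energy per frequency divided by the spacing
      \<open>\<omega>\<close> is \<open>measure lebesgue S / pi\<close>.\<close>
    also have "\<dots> = measure lebesgue S / pi * r + (2 * of_int R + 2) * \<mu>"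
      using L0 by (simp add: \<mu>_def \<omega>_def field_simps)
    finally have F2: "real (card F2) * (1 - \<eta>) \<le> measure lebesgue S / pi * r + (2 * of_int R + 2) * \<mu>"
      using \<epsilon> by simp
    have "real (card F) * (1 - \<eta>) \<le> (N + real (card F2)) * (1 - \<eta>)"
      using cardF \<eta> by (intro mult_right_mono) auto
    also have "\<dots> \<le> N + real (card F2) * (1 - \<eta>)"
      using \<eta> by (simp add: distrib_right mult_left_le N_def)
    finally show ?thesis using F2 by (simp add: F_def)
  qed
  then show ?thesis by blast
qed

lemma upper_density_le:
  assumes t: "inj t" and fin: "\<And>b. finite {n. t n \<le> b}" and c: "c \<ge> 0"
    and card: "\<And>\<eta>. 0 < \<eta> \<Longrightarrow> \<eta> < 1 \<Longrightarrow>
      \<exists>K. \<forall>a\<ge>0. \<forall>r\<ge>0. real (card {n. t n \<in> {a..a + r}}) * (1 - \<eta>) \<le> c * r + K"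
  shows "upper_density (range t) \<le> ennreal c"
proof (rule ennreal_le_epsilon)
  fix \<delta> :: real assume \<delta>: "0 < \<delta>"
  define y where "y = c + \<delta>"
  \<comment> \<open>Chosen so that \<open>y * (1 - \<eta>) = c + \<delta> / 2\<close>; the remaining
    half of \<delta> absorbs \<open>K\<close> once \<open>r\<close> is large.\<close>
  define \<eta> where "\<eta> = \<delta> / (2 * y)"
  have y: "y > 0" using c \<delta> by (simp add: y_def)
  have \<eta>: "0 < \<eta>" "\<eta> < 1" using y \<delta> c by (simp_all add: \<eta>_def y_def field_simps)
  have \<eta>y: "y * (1 - \<eta>) = c + \<delta> / 2"
    using y by (simp add: \<eta>_def field_simps) (simp add: y_def field_simps)
  obtain K where K: "\<And>a r. a \<ge> 0 \<Longrightarrow> r \<ge> 0 \<Longrightarrow>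
      real (card {n. t n \<in> {a..a + r}}) * (1 - \<eta>) \<le> c * r + K"
    using card[OF \<eta>] by blast
  have "(SUP a\<in>{0..}. emeasure (count_space UNIV) (range t \<inter> {a..a + r}) / ennreal r) \<le> ennreal y"
    if r: "r \<ge> max 1 (2 * K / \<delta>)" for r
  proof (rule SUP_least)
    fix a :: real assume "a \<in> {0..}"
    define F where "F = {n. t n \<in> {a..a + r}}"
    have "F \<subseteq> {n. t n \<le> a + r}" by (auto simp: F_def)
    then have finF: "finite F" using fin finite_subset by blast
    have "range t \<inter> {a..a + r} = t ` F" by (auto simp: F_def)
    moreover have "card (t ` F) = card F" by (intro card_image inj_on_subset[OF t]) auto
    ultimately have em: "emeasure (count_space UNIV) (range t \<inter> {a..a + r}) = ennreal (real (card F))"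
      using finF by (simp add: emeasure_count_space_finite ennreal_of_nat_eq_real_of_nat)
    have "K \<le> \<delta> / 2 * r" using r \<delta> by (simp add: field_simps)
    then have "real (card F) * (1 - \<eta>) \<le> (c + \<delta> / 2) * r"
      using K[of a r] \<open>a \<in> {0..}\<close> r by (simp add: F_def algebra_simps)
    also have "\<dots> = y * r * (1 - \<eta>)" using \<eta>y by (simp add: mult_ac)
    finally have "real (card F) \<le> y * r" using \<eta> by simp
    then have "real (card F) / r \<le> y" using r by (simp add: divide_le_eq)
    then show "emeasure (count_space UNIV) (range t \<inter> {a..a + r}) / ennreal r \<le> ennreal y"
      using r unfolding em by (simp add: divide_ennreal ennreal_leI)
  qed
  then have "upper_density (range t) \<le> ennreal y"
    unfolding upper_density_def
    by (intro Limsup_bounded eventually_mono[OF eventually_ge_at_top[of "max 1 (2 * K / \<delta>)"]])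
  also have "\<dots> = ennreal c + ennreal \<delta>" using c \<delta> by (simp add: y_def)
  finally show "upper_density (range t) \<le> ennreal c + ennreal \<delta>" .
qed

theorem theorem2:
  fixes \<alpha> :: real and S :: "real set" and t :: "nat \<Rightarrow> real"
  assumes "S \<in> sets lebesgue" and "bounded S" and "S \<subseteq> {0<..}"
    and "\<alpha> > -1/2"
    and "inj t" and "range t \<subseteq> {0<..}"
    and "interpolation_set \<alpha> S t"
  shows "upper_density (range t) \<le> ennreal (1 / pi * measure lebesgue S)"
proof -
  \<comment> \<open>The Hankel kernel depends on the product of its arguments only, so the functions
    attached to the points are dilates of a single one.\<close>
  define \<kappa> where "\<kappa> u = sqrt u * bessel_J \<alpha> u" for u
  have t: "t n > 0" for n using assms(6) by auto
  obtain B where B: "B > 0" "S \<subseteq> {0<..B}"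
    using assms(2,3) unfolding bounded_pos by force
  have SL: "S \<in> lmeasurable" using assms(1,2) bounded_set_imp_lmeasurable by blast
  have \<kappa>: "continuous_on {0..} \<kappa>"
    unfolding \<kappa>_def by (rule continuous_on_sqrt_bessel_J) (use assms(4) in simp)
  obtain m where m: "\<And>u. 0 \<le> u \<Longrightarrow> \<bar>\<kappa> u\<bar> \<le> m"
    using sqrt_bessel_J_bounded[of \<alpha>] assms(4) unfolding \<kappa>_def by auto
  have "\<alpha> > -1" using assms(4) by simp
  then obtain a b where "((\<lambda>u. \<kappa> u - (a * sin u + b * cos u)) \<longlongrightarrow> 0) at_top"
    using sqrt_bessel_J_asymptotics unfolding \<kappa>_def by blast
  moreover obtain D \<theta> where "\<And>u. a * sin u + b * cos u = D * cos (u + \<theta>)"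
    using polar_form_cos_sin by blast
  ultimately have asymp: "((\<lambda>u. \<kappa> u - D * cos (u + \<theta>)) \<longlongrightarrow> 0) at_top" by simp
  have e: "square_integrable lebesgue (\<lambda>x. indicator S x * \<kappa> (t n * x))" for n
  proof (rule square_integrable_indicator_mult[OF SL])
    show "(\<lambda>x. \<kappa> (t n * x)) \<in> borel_measurable (lebesgue_on S)"
      using assms(3) t[of n]
      by (intro continuous_imp_measurable_on_sets_lebesgue assms(1) continuous_on_compose2[OF \<kappa>] continuous_intros)
         (auto intro: less_imp_le)
    show "\<bar>\<kappa> (t n * x)\<bar> \<le> m" if "x \<in> S" for x
      using that assms(3) t[of n] by (intro m) auto
  qed
  have "\<exists>g. square_integrable lebesgue g \<and>
      (\<forall>n. L2_inner lebesgue (\<lambda>x. indicator S x * \<kappa> (t n * x)) g = a n)"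
    if "summable (\<lambda>n. (a n)\<^sup>2)" for a
    using hankel_space_moment[OF assms(1,3) t assms(7) that] e unfolding \<kappa>_def by blast
  from riesz_lower_bound_of_moment_problem[OF e this] obtain C where C: "C > 0"
    and riesz: "\<And>F c. finite F \<Longrightarrow> (\<Sum>i\<in>F. (c i)\<^sup>2)
      \<le> C * L2_inner lebesgue (\<lambda>x. \<Sum>i\<in>F. c i * (indicator S x * \<kappa> (t i * x)))
             (\<lambda>x. \<Sum>i\<in>F. c i * (indicator S x * \<kappa> (t i * x)))"
    by auto
  have fin: "finite {n. t n \<le> b}" for b
    by (rule finite_points_of_riesz_bound[OF SL B(2,1) \<kappa> assms(5) t C riesz])
  show ?thesis
    using upper_density_le[OF assms(5) fin _ card_points_le[OF assms(1) B(2,1) \<kappa> m asymp e C riesz fin]]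
    by simp
qed

end
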